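(* For $n\ge0$, let $c_{0,0}(2n)$ be the number of square lattice walks of length $2n$ (steps $(1,0),(-1,0),(0,1),(0,-1)$), starting and ending at $(0,0)$, all of whose vertices lie in $\mathcal C=\{(i,j)\in\mathbb Z^2:i\ge0\text{ or }j\ge0\}$. Then $$\begin{aligned}c_{0,0}(2n)=\frac{4\cdot16^n}{3^5}\Bigg(&3^4\,\frac{(1/2)_n(1/2)_{n+1}}{(2)_n(2)_{n+1}}+4(24n^2+60n+29)\,\frac{(1/2)_n(7/6)_n}{(2)_{n+1}(4/3)_{n+1}}\\&-2(12n^2+30n+5)\,\frac{(1/2)_n(5/6)_n}{(2)_{n+1}(5/3)_{n+1}}\Bigg),\end{aligned}$$ and, as $n\to\infty$, $$c_{0,0}(2n)\sim\frac{2^9}{3^4}\,\frac{\Gamma(2/3)}{\pi}\,\frac{4^{2n}}{(2n)^{5/3}}.$$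
   Context: $(a)_n=a(a+1)\cdots(a+n-1)$ denotes the ascending factorial, with $(a)_0=1$. *)

theory Defs
  imports "HOL-Analysis.Analysis" "HOL-Library.Landau_Symbols"
begin

unbundle asymp_equiv_syntax

definition lattice_steps :: "(int \<times> int) set" where
  "lattice_steps = {(1, 0), (-1, 0), (0, 1), (0, -1)}"

definition three_quadrant_cone :: "(int \<times> int) set" where
  "three_quadrant_cone = {(i, j). i \<ge> 0 \<or> j \<ge> 0}"

text \<open>A walk of length \<open>m\<close> is the list of its \<open>m + 1\<close> vertices. Since the four steps
  are pairwise distinct, this determines the sequence of steps and vice versa.\<close>

definition square_walks ::
    "(int \<times> int) set \<Rightarrow> int \<times> int \<Rightarrow> int \<times> int \<Rightarrow> nat \<Rightarrow> (int \<times> int) list set" where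
  "square_walks D p q m =
     {w. length w = m + 1 \<and> w ! 0 = p \<and> w ! m = q \<and> set w \<subseteq> D \<and>
         (\<forall>k<m. (fst (w ! Suc k) - fst (w ! k), snd (w ! Suc k) - snd (w ! k)) \<in> lattice_steps)}"

definition cone_walk_count :: "int \<Rightarrow> int \<Rightarrow> nat \<Rightarrow> nat" where
  "cone_walk_count i j m = card (square_walks three_quadrant_cone (0, 0) (i, j) m)"

text \<open>The cardinality above is never the default value of \<open>card\<close> on infinite sets.\<close>

lemma finite_square_walks: "finite (square_walks D p q m)"
proof -
  have "\<exists>B. finite B \<and> {w. length w = m + 1 \<and> w ! 0 = p \<and>
         (\<forall>k<m. (fst (w ! Suc k) - fst (w ! k), snd (w ! Suc k) - snd (w ! k)) \<in> lattice_steps)} \<subseteq> B"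
  proof (induction m)
    case 0
    have "w = [p]" if "length w = 0 + 1" "w ! 0 = p" for w
      using that by (cases w) auto
    then show ?case by (intro exI[of _ "{[p]}"]) auto
  next
    case (Suc m)
    then obtain B where B: "finite B" and sub: "\<And>w. length w = m + 1 \<Longrightarrow> w ! 0 = p \<Longrightarrow>
         (\<forall>k<m. (fst (w ! Suc k) - fst (w ! k), snd (w ! Suc k) - snd (w ! k)) \<in> lattice_steps) \<Longrightarrow> w \<in> B"
      by blast
    let ?B' = "(\<lambda>(v, s). v @ [(fst (v ! m) + fst s, snd (v ! m) + snd s)]) ` (B \<times> lattice_steps)"
    have "finite ?B'" using B by (simp add: lattice_steps_def)
    moreover have "w \<in> ?B'" if len: "length w = Suc m + 1" and hd: "w ! 0 = p"
      and st: "\<forall>k<Suc m. (fst (w ! Suc k) - fst (w ! k), snd (w ! Suc k) - snd (w ! k)) \<in> lattice_steps"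
      for w
    proof -
      let ?s = "(fst (w ! Suc m) - fst (w ! m), snd (w ! Suc m) - snd (w ! m))"
      have "take (Suc m) w \<in> B" by (rule sub) (use len hd st in auto)
      moreover have "?s \<in> lattice_steps" using st by blast
      moreover have "w = take (Suc m) w @ [w ! Suc m]"
        using len by (metis add.commute lessI plus_1_eq_Suc take_Suc_conv_app_nth take_all order_refl)
      ultimately show ?thesis
        by (intro image_eqI[of _ _ "(take (Suc m) w, ?s)"]) (auto simp del: take_Suc)
    qed
    ultimately show ?case by (intro exI[of _ ?B']) blast
  qed
  then show ?thesis
    unfolding square_walks_def by (auto elim!: finite_subset[rotated])
qed

end

theory Submission
  imports Defs "HOL-Computational_Algebra.Formal_Power_Series" "HOL-Real_Asymp.Real_Asymp"
begin

text \<open>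
  The cone has opening angle \<open>3\<pi>/2\<close>, and walks in it that are killed on the boundary extend by
  reflection to the three-sheeted covering of the punctured lattice.  The part of the extension that
  is invariant under the deck group lives on the lattice itself and is, up to the factor \<open>1/3\<close>, the
  reflected walk count of the quadrant.  Subtracting it from the cone count leaves numbers that
  satisfy the same recurrence in the cone, and their generating function is algebraic.  The Catalan
  term of the formula is the part subtracted, and the two other terms are the algebraic part.

  By the symmetry in the diagonal it is enough to follow the reduced numbers in the half of the cone
  below the diagonal.  With \<open>t\<close> for the length, \<open>x\<close> for the distance from the vertical boundary line
  and \<open>y\<close> for the distance from the diagonal, their recurrence becomes a linear equation
  between a series \<open>D(x)\<close>, for walks ending on the diagonal, and a series \<open>B(y)\<close>, for walks ending next
  to the boundary (\<open>functional_equation\<close>).  Its coefficients are evaluated on the kernel curve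
  \<open>xy = t(1+x)(1+xy\<^sup>2)\<close>, where the unknown bulk series drops out.

  The kernel curve is uniformized by two independent variables \<open>V\<close> and \<open>W\<close> with \<open>t = V W\<close> such that
  \<open>x\<close> is a power series in \<open>V\<close> and \<open>t\<close> while \<open>y\<close> is a power series in \<open>W\<close> and \<open>t\<close> (\<open>kernel\<close>).  The
  variable \<open>1/W\<close> is an invariant in the sense of Tutte: on the curve it is at the same time a function
  of \<open>x\<close> and a function of \<open>y\<close>.  On this curve the linear equation takes the form \<open>f = W\<^sup>2 g\<close>, where
  \<open>f\<close> is a series in \<open>W\<close> and \<open>t\<close>, and \<open>g\<close> a series in \<open>V\<close> and \<open>t\<close> (\<open>uniformized\<close>).  A comparison of
  monomials shows that \<open>g\<close> is a quadratic polynomial in \<open>V\<close> over the series in \<open>t\<close> (\<open>sides_match\<close>),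
  so that a single unknown coefficient is read off on both sides (\<open>diagonal_series\<close>).

  The coefficients of the uniformization are rational functions of one algebraic series \<open>Z\<close> in \<open>t\<^sup>2\<close>, and
  so is the generating function of the reduced numbers at the origin.  Two Laurent polynomials in
  \<open>Z\<close> satisfy the hypergeometric differential equations of the two sequences in the formula
  (\<open>ode1\<close>, \<open>ode2\<close>), and a combination of their derivatives is the generating function wanted
  (\<open>combination\<close>).  The asymptotic statement follows from Euler's limit for the Gamma function: the
  three terms of the formula are of order \<open>n powr -3\<close>, \<open>n powr (-5/3)\<close> and \<open>n powr (-7/3)\<close> relative
  to \<open>16 ^ n\<close>, and the constant of the second one is simplified by the duplication formula.
\<close>

section \<open>Bivariate power series\<close>

text \<open>The outer variable is \<open>V\<close> and the inner variable is \<open>W\<close>.  The series \<open>bT\<close> plays the role of the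
  length variable \<open>t\<close>, so that \<open>W = t/V\<close>: a series in \<open>V\<close> and \<open>W\<close> is a Laurent expansion in \<open>V\<close> over
  the series in \<open>t\<close>.\<close>

type_synonym bps = "real fps fps"

definition bV :: bps where "bV = fps_X"
definition bW :: bps where "bW = fps_const fps_X"
definition bT :: bps where "bT = bV * bW"

abbreviation const0 :: "bps \<Rightarrow> real" where "const0 f \<equiv> fps_nth (fps_nth f 0) 0"

text \<open>The series whose exponents lie in a given additive set form a subring.  The two subrings needed are
  the power series in \<open>V\<close> and \<open>t\<close> (exponents \<open>i \<ge> j\<close>) and those in \<open>W\<close> and \<open>t\<close> (exponents \<open>i \<le> j\<close>).\<close>

definition supp :: "(nat \<Rightarrow> nat \<Rightarrow> bool) \<Rightarrow> bps set" where
  "supp P = {f. \<forall>i j. fps_nth (fps_nth f i) j \<noteq> 0 \<longrightarrow> P i j}"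

definition additive_pred :: "(nat \<Rightarrow> nat \<Rightarrow> bool) \<Rightarrow> bool" where
  "additive_pred P \<longleftrightarrow> P 0 0 \<and> (\<forall>a b c d. P a b \<longrightarrow> P c d \<longrightarrow> P (a + c) (b + d))"

lemma bps_mult_nth:
  "fps_nth (fps_nth (f * g :: bps) i) j =
     (\<Sum>a\<le>i. \<Sum>b\<le>j. fps_nth (fps_nth f a) b * fps_nth (fps_nth g (i - a)) (j - b))"
  by (simp add: fps_mult_nth fps_sum_nth atLeast0AtMost)

lemma bps_numeral_nth:
  "fps_nth (fps_nth (numeral k :: bps) i) j = (if i = 0 \<and> j = 0 then numeral k else 0)"
  by (simp add: fps_numeral_nth)

lemma bps_const_nth:
  "fps_nth (fps_nth (fps_const (fps_const c) :: bps) i) j = (if i = 0 \<and> j = 0 then c else 0)"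
  by simp

lemma const0_mult [simp]: "const0 (f * g) = const0 f * const0 g"
  by (simp add: bps_mult_nth)

lemma const0_power [simp]: "const0 (f ^ n) = const0 f ^ n"
  by (induction n) (simp_all del: fps_mult_nth_0)

lemma const0_simps [simp]: "const0 bV = 0" "const0 bW = 0" "const0 bT = 0"
  by (simp_all add: bV_def bW_def bT_def)

context
  fixes P assumes P: "additive_pred P"
begin

lemma supp_0 [simp]: "0 \<in> supp P"
  by (simp add: supp_def)

lemma supp_const [simp]: "fps_const (fps_const c) \<in> supp P"
  using P by (auto simp: supp_def additive_pred_def)

lemma supp_1 [simp]: "1 \<in> supp P"
  using P by (auto simp: supp_def additive_pred_def split: if_splits)

lemma supp_numeral [simp]: "numeral k \<in> supp P"
  using P by (auto simp: supp_def additive_pred_def bps_numeral_nth split: if_splits)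

lemma supp_add: "f \<in> supp P \<Longrightarrow> g \<in> supp P \<Longrightarrow> f + g \<in> supp P"
  unfolding supp_def by (auto) (metis add.right_neutral)

lemma supp_uminus: "f \<in> supp P \<Longrightarrow> - f \<in> supp P"
  unfolding supp_def by auto

lemma supp_diff: "f \<in> supp P \<Longrightarrow> g \<in> supp P \<Longrightarrow> f - g \<in> supp P"
  unfolding supp_def by (auto) (metis diff_self)

lemma supp_mult:
  assumes "f \<in> supp P" "g \<in> supp P" shows "f * g \<in> supp P"
  unfolding supp_def
proof (intro CollectI allI impI)
  fix i j assume "fps_nth (fps_nth (f * g) i) j \<noteq> 0"
  then obtain a b where ab: "a \<le> i" "b \<le> j"
    "fps_nth (fps_nth f a) b * fps_nth (fps_nth g (i - a)) (j - b) \<noteq> 0"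
    unfolding bps_mult_nth by (metis (no_types, lifting) atMost_iff sum.neutral)
  then have "P a b" "P (i - a) (j - b)" using assms by (auto simp: supp_def)
  then have "P (a + (i - a)) (b + (j - b))" using P by (auto simp: additive_pred_def)
  then show "P i j" using ab by simp
qed

lemma supp_power: "f \<in> supp P \<Longrightarrow> f ^ n \<in> supp P"
  by (induction n) (auto intro: supp_mult)

lemma supp_sum: "(\<And>i. i \<in> I \<Longrightarrow> f i \<in> supp P) \<Longrightarrow> sum f I \<in> supp P"
  by (induction I rule: infinite_finite_induct) (auto intro: supp_add)

end

lemmas supp_intros = supp_0 supp_1 supp_const supp_numeral supp_add supp_uminus supp_diff supp_mult
  supp_power

lemma bps_inverse:
  fixes f :: bps
  assumes "const0 f \<noteq> 0"
  shows "f * inverse f = 1"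
proof -
  have "fps_nth f 0 * inverse (fps_nth f 0) = 1"
    using assms by (intro inverse_mult_eq_1') simp
  then show ?thesis
    by (subst fps_inverse_def) (rule fps_right_inverse)
qed

lemma const0_inverse [simp]:
  assumes "const0 f \<noteq> 0" shows "const0 (inverse f) = inverse (const0 f)"
proof -
  have "const0 (f * inverse f) = const0 1" using bps_inverse[OF assms] by simp
  then have "const0 f * const0 (inverse f) = 1" by (simp only: const0_mult) simp
  then show ?thesis using assms by (simp add: field_simps)
qed

text \<open>At a minimal exponent of \<open>g\<close> outside the additive set only the constant term of \<open>f\<close> can contribute to
  the product: an exponent in the set cannot be completed by another one in the set.  This makes the
  subrings closed under inverses, and the same reasoning works for square roots.\<close>

lemma supp_cofactor_aux:
  assumes P: "additive_pred P" and f: "f \<in> supp P"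
    and nz: "\<not> P i j"
    and small: "\<And>c d. c + d < i + j \<Longrightarrow> \<not> P c d \<Longrightarrow> fps_nth (fps_nth g c) d = 0"
  shows "fps_nth (fps_nth (f * g) i) j = const0 f * fps_nth (fps_nth g i) j"
proof -
  have z: "fps_nth (fps_nth f a) b * fps_nth (fps_nth g (i - a)) (j - b) = 0"
    if ab: "a \<le> i" "b \<le> j" "(a, b) \<noteq> (0, 0)" for a b
  proof (cases "P a b")
    case True
    have "\<not> P (i - a) (j - b)"
    proof
      assume "P (i - a) (j - b)"
      then have "P (a + (i - a)) (b + (j - b))" using True P by (auto simp: additive_pred_def)
      then show False using ab nz by simp
    qed
    moreover have "(i - a) + (j - b) < i + j" using ab by auto
    ultimately show ?thesis using small by simp
  next
    case False
    then show ?thesis using f by (auto simp: supp_def)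
  qed
  have "fps_nth (fps_nth (f * g) i) j =
      (\<Sum>(a,b)\<in>{..i}\<times>{..j}. fps_nth (fps_nth f a) b * fps_nth (fps_nth g (i - a)) (j - b))"
    by (simp add: bps_mult_nth sum.cartesian_product)
  also have "\<dots> = (\<Sum>(a,b)\<in>{(0,0)}. fps_nth (fps_nth f a) b * fps_nth (fps_nth g (i - a)) (j - b))"
  proof (rule sum.mono_neutral_right)
    show "\<forall>p\<in>{..i} \<times> {..j} - {(0, 0)}.
        (case p of (a, b) \<Rightarrow> fps_nth (fps_nth f a) b * fps_nth (fps_nth g (i - a)) (j - b)) = 0"
    proof
      fix p assume p: "p \<in> {..i} \<times> {..j} - {(0, 0)}"
      obtain a b where "p = (a, b)" by force
      then show "(case p of (a, b) \<Rightarrow> fps_nth (fps_nth f a) b * fps_nth (fps_nth g (i - a)) (j - b)) = 0"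
        using p z[of a b] by auto
    qed
  qed auto
  finally show ?thesis by simp
qed

lemma supp_inverse:
  assumes P: "additive_pred P" and f: "f \<in> supp P" "const0 f \<noteq> 0"
  shows "inverse f \<in> supp P"
proof -
  have "fps_nth (fps_nth (inverse f) i) j = 0" if "\<not> P i j" for i j
    using that
  proof (induction "i + j" arbitrary: i j rule: less_induct)
    case less
    have "fps_nth (fps_nth (f * inverse f) i) j = const0 f * fps_nth (fps_nth (inverse f) i) j"
      by (rule supp_cofactor_aux[OF P f(1)]) (use less in blast)+
    moreover have "fps_nth (fps_nth (f * inverse f) i) j = 0"
      using less.prems P bps_const_nth[of 1 i j] by (auto simp: bps_inverse[OF f(2)] additive_pred_def split: if_splits)
    ultimately show ?case using f by simp
  qed
  then show ?thesis by (auto simp: supp_def)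
qed

text \<open>Square roots over a commutative ring, coefficient by coefficient: the constant term fixes
  the sign, and twice the constant term is the only thing that has to be divided by.\<close>

fun sqrt_coeffs :: "'a::comm_ring_1 \<Rightarrow> 'a \<Rightarrow> 'a fps \<Rightarrow> nat \<Rightarrow> 'a" where
  "sqrt_coeffs g0 u f n = (if n = 0 then g0 else
     u * (fps_nth f n - (\<Sum>i\<in>{1..<n}. sqrt_coeffs g0 u f i * sqrt_coeffs g0 u f (n - i))))"

declare sqrt_coeffs.simps [simp del]

lemma fps_sqrt_exists:
  fixes f :: "'a::comm_ring_1 fps"
  assumes g0: "g0 * g0 = fps_nth f 0" and u: "2 * g0 * u = 1"
  shows "\<exists>g. g * g = f \<and> fps_nth g 0 = g0"
proof -
  define s where "s = sqrt_coeffs g0 u f"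
  have s0: "s 0 = g0" by (simp add: s_def sqrt_coeffs.simps)
  have sn: "s n = u * (fps_nth f n - (\<Sum>i\<in>{1..<n}. s i * s (n - i)))" if "n > 0" for n
    using that unfolding s_def by (subst sqrt_coeffs.simps) simp
  have "fps_nth (Abs_fps s * Abs_fps s) n = fps_nth f n" for n
  proof (cases "n = 0")
    case True then show ?thesis using g0 s0 by simp
  next
    case False
    have "fps_nth (Abs_fps s * Abs_fps s) n = (\<Sum>i\<in>{0..n}. s i * s (n - i))"
      by (simp add: fps_mult_nth)
    also have "{0..n} = insert 0 (insert n {1..<n})" using False by auto
    also have "(\<Sum>i\<in>insert 0 (insert n {1..<n}). s i * s (n - i)) =
        2 * g0 * s n + (\<Sum>i\<in>{1..<n}. s i * s (n - i))"
      using False s0 by (simp add: algebra_simps)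
    also have "2 * g0 * s n = 2 * g0 * u * (fps_nth f n - (\<Sum>i\<in>{1..<n}. s i * s (n - i)))"
      using sn[of n] False by (simp add: mult.assoc)
    finally show ?thesis using u by simp
  qed
  then have "Abs_fps s * Abs_fps s = f" by (intro fps_ext)
  then show ?thesis using s0 by (intro exI[of _ "Abs_fps s"]) simp
qed

definition bsqrt :: "bps \<Rightarrow> bps" where
  "bsqrt f = (SOME g. g * g = f \<and> const0 g = 1)"

lemma bsqrt:
  assumes "const0 f = 1"
  shows "bsqrt f * bsqrt f = f" "const0 (bsqrt f) = 1"
proof -
  obtain h :: "real fps" where h: "h * h = fps_nth f 0" "fps_nth h 0 = 1"
    using fps_sqrt_exists[of 1 "fps_nth f 0" "1/2"] assms by auto
  have "2 * h * (fps_const (1/2) * inverse h) = (fps_const 2 * fps_const (1/2)) * (h * inverse h)"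
    by (simp only: fps_numeral_fps_const mult_ac)
  also have "h * inverse h = 1" using h by (intro inverse_mult_eq_1') simp
  also have "fps_const 2 * fps_const (1/2) = (1 :: real fps)" by (simp flip: fps_const_1_eq_1)
  finally have "2 * h * (fps_const (1/2) * inverse h) = 1" by simp
  then obtain g where "g * g = f" "fps_nth g 0 = h"
    using fps_sqrt_exists[of h f] h by blast
  then have "\<exists>g. g * g = f \<and> const0 g = 1" using h by auto
  from someI_ex[OF this] show "bsqrt f * bsqrt f = f" "const0 (bsqrt f) = 1"
    by (auto simp: bsqrt_def)
qed

lemma supp_bsqrt:
  assumes P: "additive_pred P" and f: "f \<in> supp P" "const0 f = 1"
  shows "bsqrt f \<in> supp P"
proof -
  define g where "g = bsqrt f"
  have g: "g * g = f" "const0 g = 1" using bsqrt[OF f(2)] by (auto simp: g_def)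
  have "fps_nth (fps_nth g i) j = 0" if "\<not> P i j" for i j
    using that
  proof (induction "i + j" arbitrary: i j rule: less_induct)
    case less
    have ij: "(i, j) \<noteq> (0, 0)" using less.prems P unfolding additive_pred_def by blast
    have z: "fps_nth (fps_nth g a) b * fps_nth (fps_nth g (i - a)) (j - b) = 0"
      if ab: "a \<le> i" "b \<le> j" "(a, b) \<noteq> (0, 0)" "(a, b) \<noteq> (i, j)" for a b
    proof (cases "P a b")
      case True
      have "\<not> P (i - a) (j - b)"
      proof
        assume "P (i - a) (j - b)"
        then have "P (a + (i - a)) (b + (j - b))" using True P by (auto simp: additive_pred_def)
        then show False using ab less.prems by simp
      qed
      moreover have "(i - a) + (j - b) < i + j" using ab by auto
      ultimately show ?thesis using less.hyps by simp
    next
      case False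
      moreover have "a + b < i + j" using ab by auto
      ultimately show ?thesis using less.hyps by simp
    qed
    have "fps_nth (fps_nth (g * g) i) j =
        (\<Sum>(a,b)\<in>{..i}\<times>{..j}. fps_nth (fps_nth g a) b * fps_nth (fps_nth g (i - a)) (j - b))"
      by (simp add: bps_mult_nth sum.cartesian_product)
    also have "\<dots> = (\<Sum>(a,b)\<in>{(0,0),(i,j)}. fps_nth (fps_nth g a) b * fps_nth (fps_nth g (i - a)) (j - b))"
    proof (rule sum.mono_neutral_right)
      show "\<forall>p\<in>{..i} \<times> {..j} - {(0, 0), (i, j)}.
          (case p of (a, b) \<Rightarrow> fps_nth (fps_nth g a) b * fps_nth (fps_nth g (i - a)) (j - b)) = 0"
      proof
        fix p assume p: "p \<in> {..i} \<times> {..j} - {(0, 0), (i, j)}"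
        obtain a b where "p = (a, b)" by force
        then show "(case p of (a, b) \<Rightarrow> fps_nth (fps_nth g a) b * fps_nth (fps_nth g (i - a)) (j - b)) = 0"
          using p z[of a b] by auto
      qed
    qed auto
    also have "\<dots> = 2 * fps_nth (fps_nth g i) j" using ij g(2) by auto
    finally have "fps_nth (fps_nth f i) j = 2 * fps_nth (fps_nth g i) j" unfolding g(1) .
    moreover have "fps_nth (fps_nth f i) j = 0" using f(1) less.prems unfolding supp_def by blast
    ultimately show ?case by simp
  qed
  then show ?thesis by (auto simp: supp_def g_def)
qed

definition vside :: "nat \<Rightarrow> nat \<Rightarrow> bool" where "vside i j \<longleftrightarrow> j \<le> i"
definition wside :: "nat \<Rightarrow> nat \<Rightarrow> bool" where "wside i j \<longleftrightarrow> i \<le> j"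

lemma vside_iff: "f \<in> supp vside \<longleftrightarrow> (\<forall>i j. i < j \<longrightarrow> fps_nth (fps_nth f i) j = 0)"
  by (auto simp: supp_def vside_def) (meson not_le)+

lemma wside_iff: "f \<in> supp wside \<longleftrightarrow> (\<forall>i j. j < i \<longrightarrow> fps_nth (fps_nth f i) j = 0)"
  by (auto simp: supp_def wside_def) (meson not_le)+

lemma additive_sides [simp]: "additive_pred vside" "additive_pred wside"
  by (auto simp: additive_pred_def vside_def wside_def)

lemma bV_vside [simp]: "bV \<in> supp vside"
  by (auto simp: supp_def bV_def vside_def)

lemma bW_wside [simp]: "bW \<in> supp wside"
  by (auto simp: supp_def bW_def wside_def)

lemma bVmult_nth: "fps_nth (fps_nth (bV * f) i) j = (if i = 0 then 0 else fps_nth (fps_nth f (i - 1)) j)"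
  by (simp add: bV_def)

lemma bWmult_nth: "fps_nth (fps_nth (bW * f) i) j = (if j = 0 then 0 else fps_nth (fps_nth f i) (j - 1))"
  by (simp add: bW_def)

lemma bT_sides [simp]: "bT \<in> supp vside" "bT \<in> supp wside"
  unfolding bT_def supp_def mem_Collect_eq bVmult_nth
  by (auto simp: bW_def vside_def wside_def split: if_splits)

text \<open>The substitution of \<open>t = V W\<close> for the variable of a univariate series.  Its range is the intersection of
  the two subrings.\<close>

definition diag :: "real fps \<Rightarrow> bps" where
  "diag h = Abs_fps (\<lambda>i. fps_const (fps_nth h i) * fps_X ^ i)"

lemma diag_nth: "fps_nth (fps_nth (diag h) i) j = (if i = j then fps_nth h i else 0)"
  by (simp add: diag_def fps_X_power_nth)

lemma diag_add [simp]: "diag (f + g) = diag f + diag g"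
  by (intro fps_ext) (simp add: diag_nth)
lemma diag_diff [simp]: "diag (f - g) = diag f - diag g"
  by (intro fps_ext) (simp add: diag_nth)
lemma diag_uminus [simp]: "diag (- f) = - diag f"
  by (intro fps_ext) (simp add: diag_nth)
lemma diag_const [simp]: "diag (fps_const c) = fps_const (fps_const c)"
  by (intro fps_ext) (auto simp add: diag_nth)
lemma diag_1 [simp]: "diag 1 = 1"
  by (intro fps_ext) (auto simp add: diag_nth)
lemma diag_numeral [simp]: "diag (numeral n) = numeral n"
  by (intro fps_ext) (auto simp add: diag_nth bps_numeral_nth fps_numeral_nth)
lemma diag_X [simp]: "diag fps_X = bT"
  unfolding bT_def
  by (intro fps_ext, subst bVmult_nth) (auto simp add: diag_nth bW_def)
lemma diag_mult [simp]: "diag (f * g) = diag f * diag g"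
proof (rule fps_ext)
  fix n
  have "fps_nth (diag f * diag g) n =
      (\<Sum>i=0..n. fps_const (fps_nth f i) * fps_const (fps_nth g (n - i)) * (fps_X ^ i * fps_X ^ (n - i)))"
    by (simp add: fps_mult_nth diag_def mult_ac)
  also have "\<dots> = (\<Sum>i=0..n. fps_const (fps_nth f i * fps_nth g (n - i)) * fps_X ^ n)"
    by (rule sum.cong) (auto simp flip: power_add)
  also have "\<dots> = (\<Sum>i=0..n. fps_const (fps_nth f i * fps_nth g (n - i))) * fps_X ^ n"
    by (simp add: sum_distrib_right)
  also have "(\<Sum>i=0..n. fps_const (fps_nth f i * fps_nth g (n - i)))
      = fps_const (\<Sum>i=0..n. fps_nth f i * fps_nth g (n - i))"
    by (rule fps_ext) (simp add: fps_sum_nth)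
  finally show "fps_nth (diag (f * g)) n = fps_nth (diag f * diag g) n"
    by (simp add: diag_def fps_mult_nth)
qed
lemma diag_power [simp]: "diag (f ^ n) = diag f ^ n"
  by (induction n) auto

lemma diag_sides [simp]: "diag f \<in> supp vside" "diag f \<in> supp wside"
  by (auto simp: supp_def diag_nth vside_def wside_def)

lemma const0_diag [simp]: "const0 (diag f) = fps_nth f 0"
  by (simp add: diag_nth)

lemma vside_decomp:
  assumes "f \<in> supp vside"
  obtains c g where "f = diag c + bV * g" "g \<in> supp vside"
proof
  define c where "c = Abs_fps (\<lambda>i. fps_nth (fps_nth f i) i)"
  define g where "g = Abs_fps (\<lambda>i. fps_nth (f - diag c) (Suc i))"
  show "f = diag c + bV * g"
  proof (intro fps_ext)
    fix i j
    have "fps_nth (fps_nth f 0) j = 0" if "j \<noteq> 0"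
      using assms that by (auto simp: supp_def vside_def)
    then show "fps_nth (fps_nth f i) j = fps_nth (fps_nth (diag c + bV * g) i) j"
      by (auto simp: bVmult_nth g_def diag_nth c_def simp del: fps_mult_nth_0)
  qed
  show "g \<in> supp vside"
    using assms by (auto simp: vside_iff g_def diag_nth c_def)
qed

lemma vside_decomp_unique:
  assumes "diag c + bV * f = diag d + bV * g" "f \<in> supp vside" "g \<in> supp vside"
  shows "c = d \<and> f = g"
proof -
  have z: "fps_nth (fps_nth (bV * h) n) n = 0" if "h \<in> supp vside" for h n
    using that by (auto simp: bVmult_nth vside_iff)
  have "c = d"
  proof (rule fps_ext)
    fix n
    from arg_cong[OF assms(1), of "\<lambda>h. fps_nth (fps_nth h n) n"]
    show "fps_nth c n = fps_nth d n"
      unfolding fps_add_nth z[OF assms(2)] z[OF assms(3)] by (simp add: diag_nth)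
  qed
  moreover from this have "bV * f = bV * g" using assms by simp
  then have "f = g" by (simp add: bV_def)
  ultimately show ?thesis by simp
qed

lemma wside_decomp_unique:
  assumes "diag c + bW * f = diag d + bW * g" "f \<in> supp wside" "g \<in> supp wside"
  shows "c = d \<and> f = g"
proof -
  have z: "fps_nth (fps_nth (bW * h) n) n = 0" if "h \<in> supp wside" for h n
    using that by (auto simp: bWmult_nth wside_iff)
  have "c = d"
  proof (rule fps_ext)
    fix n
    from arg_cong[OF assms(1), of "\<lambda>h. fps_nth (fps_nth h n) n"]
    show "fps_nth c n = fps_nth d n"
      unfolding fps_add_nth z[OF assms(2)] z[OF assms(3)] by (simp add: diag_nth)
  qed
  moreover from this have "bW * f = bW * g" using assms by simp
  then have "f = g" by (simp add: bW_def)
  ultimately show ?thesis by simp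
qed

text \<open>This replaces the invariant lemma of Tutte's method.  The exponents of \<open>W\<^sup>2 g\<close> satisfy \<open>j \<le> i + 2\<close>,
  and those of \<open>f\<close> satisfy \<open>i \<le> j\<close>; what the two sides share are the three diagonals \<open>j - i = 0, 1, 2\<close>.\<close>

lemma sides_match:
  assumes "f \<in> supp wside" "g \<in> supp vside" "f = bW\<^sup>2 * g"
  obtains q0 q1 q2 where "g = diag q0 + bV * diag q1 + bV\<^sup>2 * diag q2"
    "f = diag (fps_X\<^sup>2 * q2) + bW * diag (fps_X * q1) + bW\<^sup>2 * diag q0"
proof -
  from vside_decomp[OF assms(2)] obtain q0 g1 where g1: "g = diag q0 + bV * g1" "g1 \<in> supp vside" .
  from vside_decomp[OF g1(2)] obtain q1 g2 where g2: "g1 = diag q1 + bV * g2" "g2 \<in> supp vside" .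
  from vside_decomp[OF g2(2)] obtain q2 g3 where g3: "g2 = diag q2 + bV * g3" "g3 \<in> supp vside" .
  have g: "g = diag q0 + bV * diag q1 + bV\<^sup>2 * diag q2 + bV ^ 3 * g3"
    using g1(1) g2(1) g3(1) by (simp add: algebra_simps power2_eq_square power3_eq_cube)
  have f: "f = diag (fps_X\<^sup>2 * q2) + bW * diag (fps_X * q1) + bW\<^sup>2 * diag q0 + bV * (bT\<^sup>2 * g3)"
    unfolding assms(3) g diag_mult diag_power diag_X bT_def
    by (simp add: algebra_simps power2_eq_square power3_eq_cube)
  have "bV * (bT\<^sup>2 * g3) = f - (diag (fps_X\<^sup>2 * q2) + bW * diag (fps_X * q1) + bW\<^sup>2 * diag q0)"
    using f by simp
  also have "\<dots> \<in> supp wside"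
    by (intro supp_intros assms additive_sides diag_sides bW_wside)
  finally have w: "bV * (bT\<^sup>2 * g3) \<in> supp wside" .
  have v: "bT\<^sup>2 * g3 \<in> supp vside"
    by (intro supp_intros g3 additive_sides bT_sides)
  have "bV * (bT\<^sup>2 * g3) = 0"
  proof (intro fps_ext, rule ccontr)
    fix i j
    assume nz: "fps_nth (fps_nth (bV * (bT\<^sup>2 * g3)) i) j \<noteq> fps_nth (fps_nth 0 i) j"
    then have "i \<le> j" using w by (auto simp: supp_def wside_def)
    moreover have "i \<noteq> 0" "fps_nth (fps_nth (bT\<^sup>2 * g3) (i - 1)) j \<noteq> 0"
      using nz by (auto simp: bVmult_nth simp del: fps_mult_nth_0 split: if_splits)
    then have "j \<le> i - 1" "i \<noteq> 0" using v by (auto simp: supp_def vside_def)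
    ultimately show False by simp
  qed
  then have "g3 = 0" by (simp add: bT_def bV_def bW_def)
  with f g show ?thesis by (intro that[of q0 q1 q2]) auto
qed

text \<open>The sum of \<open>a\<^sub>n t\<^sup>n\<close>, where the \<open>a\<^sub>n\<close> may involve \<open>V\<close> and \<open>W\<close>.  It is finite in each degree because
  \<open>t\<^sup>n\<close> is divisible by \<open>V\<^sup>n\<close>.\<close>

definition tsum :: "(nat \<Rightarrow> bps) \<Rightarrow> bps" where
  "tsum a = Abs_fps (\<lambda>k. \<Sum>n\<le>k. fps_nth (a n * bT ^ n) k)"

lemma bT_power_nth_less:
  assumes "k < n" shows "fps_nth (f * bT ^ n) k = 0"
proof -
  have "fps_nth (fps_X ^ n * (f * bW ^ n)) k = 0"
    using assms by (simp only: fps_X_power_mult_nth if_True)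
  also have "fps_X ^ n * (f * bW ^ n) = f * bT ^ n"
    unfolding bT_def bV_def power_mult_distrib by (simp only: mult_ac)
  finally show ?thesis .
qed

lemma tsum_add: "tsum (\<lambda>n. a n + b n) = tsum a + tsum b"
  by (rule fps_ext) (simp add: tsum_def sum.distrib distrib_right)

lemma tsum_mult: "tsum (\<lambda>n. c * a n) = c * tsum a"
proof (rule fps_ext)
  fix k
  have "fps_nth (c * tsum a) k = (\<Sum>i=0..k. \<Sum>n\<le>k - i. fps_nth c i * fps_nth (a n * bT ^ n) (k - i))"
    by (simp add: fps_mult_nth[of c] tsum_def sum_distrib_left)
  also have "\<dots> = (\<Sum>i=0..k. \<Sum>n\<le>k. fps_nth c i * fps_nth (a n * bT ^ n) (k - i))"
    by (intro sum.cong refl sum.mono_neutral_left) (auto simp: bT_power_nth_less)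
  also have "\<dots> = (\<Sum>n\<le>k. \<Sum>i=0..k. fps_nth c i * fps_nth (a n * bT ^ n) (k - i))"
    by (rule sum.swap)
  also have "\<dots> = (\<Sum>n\<le>k. fps_nth (c * (a n * bT ^ n)) k)"
    by (simp add: fps_mult_nth[of c])
  finally show "fps_nth (tsum (\<lambda>n. c * a n)) k = fps_nth (c * tsum a) k"
    by (simp add: tsum_def mult.assoc)
qed

lemma tsum_diff: "tsum (\<lambda>n. a n - b n) = tsum a - tsum b"
  by (rule fps_ext) (simp add: tsum_def sum_subtractf left_diff_distrib)

lemma tsum_step: "tsum a = a 0 + bT * tsum (\<lambda>n. a (Suc n))"
proof (rule fps_ext)
  fix k
  have "fps_nth (bT * tsum (\<lambda>n. a (Suc n))) k = (\<Sum>n\<le>k. fps_nth (a (Suc n) * bT ^ Suc n) k)"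
    unfolding tsum_mult[symmetric] by (simp add: tsum_def mult_ac)
  also have "\<dots> = (\<Sum>n<k. fps_nth (a (Suc n) * bT ^ Suc n) k)"
    by (rule sum.mono_neutral_right) (auto simp: bT_power_nth_less simp del: power_Suc)
  finally show "fps_nth (tsum a) k = fps_nth (a 0 + bT * tsum (\<lambda>n. a (Suc n))) k"
    by (simp add: tsum_def sum.atMost_shift)
qed

lemma supp_tsum:
  assumes P: "additive_pred P" "bT \<in> supp P" and a: "\<And>n. a n \<in> supp P"
  shows "tsum a \<in> supp P"
  unfolding supp_def
proof (intro CollectI allI impI)
  fix i j assume "fps_nth (fps_nth (tsum a) i) j \<noteq> 0"
  then have "(\<Sum>n\<le>i. fps_nth (fps_nth (a n * bT ^ n) i) j) \<noteq> 0"
    by (simp add: tsum_def fps_sum_nth)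
  then obtain n where "fps_nth (fps_nth (a n * bT ^ n) i) j \<noteq> 0" by (meson sum.neutral)
  moreover have "a n * bT ^ n \<in> supp P" by (intro supp_mult supp_power P a)
  ultimately show "P i j" by (auto simp: supp_def)
qed

lemma tsum_const: "tsum (\<lambda>n. fps_const (fps_const (c n))) = diag (Abs_fps c)"
proof (intro fps_ext)
  fix k j
  have "bT ^ n = diag (fps_X ^ n)" for n by simp
  then have *: "fps_nth (fps_nth (fps_const (fps_const (c n)) * bT ^ n) k) j = (if k = n \<and> j = n then c n else 0)" for n
    by (auto simp: diag_nth fps_X_power_nth simp del: diag_power)
  show "fps_nth (fps_nth (tsum (\<lambda>n. fps_const (fps_const (c n)))) k) j = fps_nth (fps_nth (diag (Abs_fps c)) k) j"
    by (simp add: tsum_def fps_sum_nth * diag_nth del: fps_mult_left_const_nth)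
      (auto intro: sum.neutral)
qed

section \<open>Walks in the cone\<close>

lemma card_square_walks_0:
  "card (square_walks D p q 0) = (if p = q \<and> p \<in> D then 1 else 0)"
proof -
  have "square_walks D p q 0 = (if p = q \<and> p \<in> D then {[p]} else {})"
  proof -
    have "w = [p]" if "length w = Suc 0" "w ! 0 = p" for w
      using that by (cases w) auto
    then have "square_walks D p q 0 \<subseteq> {[p]}" by (auto simp: square_walks_def)
    moreover have "[p] \<in> square_walks D p q 0 \<longleftrightarrow> p = q \<and> p \<in> D" by (auto simp: square_walks_def)
    ultimately show ?thesis by auto
  qed
  then show ?thesis by auto
qed

lemma card_square_walks_outside:
  "q \<notin> D \<Longrightarrow> card (square_walks D p q m) = 0"
proof -
  assume q: "q \<notin> D"
  have "q \<in> set w" if "length w = m + 1" "w ! m = q" for w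
    using that nth_mem[of m w] by simp
  then have "square_walks D p q m = {}" using q by (auto simp: square_walks_def)
  then show ?thesis by simp
qed

lemma square_walks_Suc:
  assumes "q \<in> D"
  shows "square_walks D p q (Suc m) =
    (\<lambda>w. w @ [q]) ` (\<Union>s\<in>lattice_steps. square_walks D p (fst q - fst s, snd q - snd s) m)"
proof (intro equalityI subsetI)
  fix w assume "w \<in> square_walks D p q (Suc m)"
  then have w: "length w = Suc (Suc m)" "w ! 0 = p" "w ! Suc m = q" "set w \<subseteq> D"
    and st: "\<And>k. k < Suc m \<Longrightarrow> (fst (w ! Suc k) - fst (w ! k), snd (w ! Suc k) - snd (w ! k)) \<in> lattice_steps"
    by (auto simp: square_walks_def)
  define v where "v = take (Suc m) w"
  have wv: "w = v @ [q]"
    using w unfolding v_def by (metis lessI take_Suc_conv_app_nth take_all_iff order_refl)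
  have vn: "v ! k = w ! k" if "k \<le> m" for k using that by (simp add: v_def)
  define s where "s = (fst (w ! Suc m) - fst (w ! m), snd (w ! Suc m) - snd (w ! m))"
  have "s \<in> lattice_steps" unfolding s_def by (rule st) simp
  moreover have "v \<in> square_walks D p (fst q - fst s, snd q - snd s) m"
    using w st set_take_subset[of "Suc m" w]
    by (auto simp: square_walks_def vn s_def v_def)
  ultimately show "w \<in> (\<lambda>w. w @ [q]) ` (\<Union>s\<in>lattice_steps. square_walks D p (fst q - fst s, snd q - snd s) m)"
    using wv by blast
next
  fix w assume "w \<in> (\<lambda>w. w @ [q]) ` (\<Union>s\<in>lattice_steps. square_walks D p (fst q - fst s, snd q - snd s) m)"
  then obtain s v where s: "s \<in> lattice_steps" and v: "v \<in> square_walks D p (fst q - fst s, snd q - snd s) m"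
    and w: "w = v @ [q]" by blast
  from v have v': "length v = Suc m" "v ! 0 = p" "v ! m = (fst q - fst s, snd q - snd s)" "set v \<subseteq> D"
    "\<And>k. k < m \<Longrightarrow> (fst (v ! Suc k) - fst (v ! k), snd (v ! Suc k) - snd (v ! k)) \<in> lattice_steps"
    by (auto simp: square_walks_def)
  have "(fst (w ! Suc k) - fst (w ! k), snd (w ! Suc k) - snd (w ! k)) \<in> lattice_steps" if "k < Suc m" for k
    using that v' s by (cases "k = m") (auto simp: w nth_append)
  then show "w \<in> square_walks D p q (Suc m)"
    using v' assms by (auto simp: square_walks_def w nth_append)
qed

lemma card_square_walks_Suc:
  assumes "q \<in> D"
  shows "card (square_walks D p q (Suc m)) =
    (\<Sum>s\<in>lattice_steps. card (square_walks D p (fst q - fst s, snd q - snd s) m))"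
proof -
  have "card (square_walks D p q (Suc m)) =
      card (\<Union>s\<in>lattice_steps. square_walks D p (fst q - fst s, snd q - snd s) m)"
    unfolding square_walks_Suc[OF assms] by (rule card_image) (auto simp: inj_on_def)
  also have "\<dots> = (\<Sum>s\<in>lattice_steps. card (square_walks D p (fst q - fst s, snd q - snd s) m))"
  proof (rule card_UN_disjoint)
    show "finite lattice_steps" by (simp add: lattice_steps_def)
    show "\<forall>s\<in>lattice_steps. finite (square_walks D p (fst q - fst s, snd q - snd s) m)"
      by (simp add: finite_square_walks)
    show "\<forall>s\<in>lattice_steps. \<forall>r\<in>lattice_steps. s \<noteq> r \<longrightarrow>
        square_walks D p (fst q - fst s, snd q - snd s) m \<inter> square_walks D p (fst q - fst r, snd q - snd r) m = {}"
      by (auto simp: square_walks_def prod_eq_iff)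
  qed
  finally show ?thesis .
qed

definition cone_num :: "int \<Rightarrow> int \<Rightarrow> nat \<Rightarrow> real" where
  "cone_num i j n = real (cone_walk_count i j n)"

lemma cone_num_0: "cone_num i j 0 = (if i = 0 \<and> j = 0 then 1 else 0)"
  by (auto simp: cone_num_def cone_walk_count_def card_square_walks_0 three_quadrant_cone_def)

lemma cone_num_outside: "i < 0 \<Longrightarrow> j < 0 \<Longrightarrow> cone_num i j n = 0"
  by (simp add: cone_num_def cone_walk_count_def card_square_walks_outside three_quadrant_cone_def)

lemma cone_num_Suc:
  assumes "i \<ge> 0 \<or> j \<ge> 0"
  shows "cone_num i j (Suc n) =
    cone_num (i + 1) j n + cone_num (i - 1) j n + cone_num i (j + 1) n + cone_num i (j - 1) n"
proof -
  have "(i, j) \<in> three_quadrant_cone" using assms by (simp add: three_quadrant_cone_def)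
  from card_square_walks_Suc[OF this, of "(0, 0)" n] show ?thesis
    by (simp add: cone_num_def cone_walk_count_def lattice_steps_def)
qed

lemma cone_num_sym: "cone_num i j n = cone_num j i n"
proof (induction n arbitrary: i j)
  case (Suc n)
  show ?case
  proof (cases "i \<ge> 0 \<or> j \<ge> 0")
    case True
    then have *: "j \<ge> 0 \<or> i \<ge> 0" by blast
    show ?thesis unfolding cone_num_Suc[OF True] cone_num_Suc[OF *]
      using Suc[of "i + 1" j] Suc[of "i - 1" j] Suc[of i "j + 1"] Suc[of i "j - 1"] by simp
  qed (simp add: cone_num_outside)
qed (auto simp: cone_num_0)

lemma cone_num_far: "\<bar>i\<bar> + \<bar>j\<bar> > int n \<Longrightarrow> cone_num i j n = 0"
proof (induction n arbitrary: i j)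
  case (Suc n)
  show ?case
  proof (cases "i \<ge> 0 \<or> j \<ge> 0")
    case True
    have "cone_num (i + 1) j n = 0" "cone_num (i - 1) j n = 0"
      "cone_num i (j + 1) n = 0" "cone_num i (j - 1) n = 0"
      using Suc.prems by (intro Suc.IH; linarith)+
    then show ?thesis by (simp add: cone_num_Suc[OF True])
  qed (simp add: cone_num_outside)
qed (auto simp: cone_num_0)

section \<open>Walks in the quadrant\<close>

fun line_walks :: "nat \<Rightarrow> int \<Rightarrow> real" where
  "line_walks 0 k = (if k = 0 then 1 else 0)"
| "line_walks (Suc n) k = line_walks n (k - 1) + line_walks n (k + 1)"

lemma line_walks_far: "\<bar>k\<bar> > int n \<Longrightarrow> line_walks n k = 0"
  by (induction n arbitrary: k) auto

lemma line_walks_uminus: "line_walks n (- k) = line_walks n k"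
proof (induction n arbitrary: k)
  case (Suc n)
  have "- k - 1 = - (k + 1)" "- k + 1 = - (k - 1)" by auto
  then show ?case by (simp only: line_walks.simps Suc add.commute)
qed simp

lemma line_walks_choose: "line_walks n (2 * int r - int n) = real (n choose r)"
proof (induction n arbitrary: r)
  case (Suc n)
  show ?case
  proof (cases r)
    case 0
    have "line_walks n (-2 - int n) = 0" by (rule line_walks_far) simp
    then show ?thesis using Suc[of 0] 0 by simp
  next
    case (Suc r')
    have "2 * int r - int (Suc n) - 1 = 2 * int r' - int n" "2 * int r - int (Suc n) + 1 = 2 * int r - int n"
      using Suc by auto
    then show ?thesis using Suc.IH[of r'] Suc.IH[of r] Suc by (simp only: line_walks.simps) simp
  qed
qed auto

text \<open>In the coordinates \<open>i + j\<close> and \<open>i - j\<close> a square lattice walk is a pair of independent walks on the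
  line.\<close>

definition plane_num :: "int \<Rightarrow> int \<Rightarrow> nat \<Rightarrow> real" where
  "plane_num i j n = line_walks n (i + j) * line_walks n (i - j)"

lemma plane_num_0: "plane_num i j 0 = (if i = 0 \<and> j = 0 then 1 else 0)"
  by (auto simp: plane_num_def)

lemma plane_num_Suc: "plane_num i j (Suc n) =
  plane_num (i + 1) j n + plane_num (i - 1) j n + plane_num i (j + 1) n + plane_num i (j - 1) n"
  by (simp add: plane_num_def algebra_simps)

lemma plane_num_uminus: "plane_num (- i) j n = plane_num i j n" "plane_num i (- j) n = plane_num i j n"
  using line_walks_uminus[of n "i - j"] line_walks_uminus[of n "i + j"]
  by (simp_all add: plane_num_def algebra_simps)

lemma plane_num_sym: "plane_num i j n = plane_num j i n"
  using line_walks_uminus[of n "i - j"] by (simp add: plane_num_def algebra_simps)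

lemma plane_num_far: "\<bar>i\<bar> > int n \<or> \<bar>j\<bar> > int n \<Longrightarrow> plane_num i j n = 0"
  using line_walks_far[of n "i + j"] line_walks_far[of n "i - j"]
  by (simp add: plane_num_def) linarith

text \<open>The reflection principle for the two axes \<open>i = -1\<close> and \<open>j = -1\<close>.  In the quadrant these are the numbers
  of walks from the origin; outside they are defined by odd reflection, and this extension is used on
  all of the cone.\<close>

definition quad_num :: "int \<Rightarrow> int \<Rightarrow> nat \<Rightarrow> real" where
  "quad_num i j n = plane_num i j n - plane_num (i + 2) j n - plane_num i (j + 2) n
     + plane_num (i + 2) (j + 2) n"

lemma quad_num_Suc: "quad_num i j (Suc n) =
  quad_num (i + 1) j n + quad_num (i - 1) j n + quad_num i (j + 1) n + quad_num i (j - 1) n"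
  by (simp add: quad_num_def plane_num_Suc algebra_simps)

lemma quad_num_axis: "quad_num (-1) j n = 0" "quad_num i (-1) n = 0"
  using plane_num_uminus(1)[of 1 j n] plane_num_uminus(1)[of 1 "j + 2" n]
    plane_num_uminus(2)[of i 1 n] plane_num_uminus(2)[of "i + 2" 1 n]
  by (simp_all add: quad_num_def)

lemma quad_num_sym: "quad_num i j n = quad_num j i n"
  using plane_num_sym[of i j n] plane_num_sym[of "i + 2" j n] plane_num_sym[of i "j + 2" n]
    plane_num_sym[of "i + 2" "j + 2" n]
  by (simp add: quad_num_def)

lemma quad_num_far: "\<bar>i\<bar> > int n + 2 \<or> \<bar>j\<bar> > int n + 2 \<Longrightarrow> quad_num i j n = 0"
proof -
  assume "\<bar>i\<bar> > int n + 2 \<or> \<bar>j\<bar> > int n + 2"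
  then have "plane_num i j n = 0" "plane_num (i + 2) j n = 0" "plane_num i (j + 2) n = 0"
    "plane_num (i + 2) (j + 2) n = 0"
    by (intro plane_num_far; linarith)+
  then show ?thesis by (simp add: quad_num_def)
qed

lemma quad_num_0: "quad_num i j 0 = (if (i = 0 \<or> i = -2) \<and> (j = 0 \<or> j = -2) then
   (if i = j then 1 else -1) else 0)"
  by (auto simp: quad_num_def plane_num_0)

lemma quad_num_origin:
  "quad_num 0 0 (2 * n) = real (2*n choose n) ^ 2 - 2 * real (2*n choose (n+1)) ^ 2
     + real (2*n choose n) * real (2*n choose (n+2))"
  using line_walks_choose[of "2*n" n] line_walks_choose[of "2*n" "n+1"] line_walks_choose[of "2*n" "n+2"]
    line_walks_uminus[of "2*n" 2]
  by (simp add: quad_num_def plane_num_def power2_eq_square algebra_simps)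

section \<open>The generating functions\<close>

text \<open>The weight \<open>1/3\<close> is the one for which the sources \<open>2/3, 1/3, 1/3\<close> at \<open>(0,0)\<close>, \<open>(0,-2)\<close> and \<open>(-2,0)\<close>
  have no component that is invariant under the deck group; algebraicity depends on it.\<close>

definition reduced_num :: "int \<Rightarrow> int \<Rightarrow> nat \<Rightarrow> real" where
  "reduced_num i j n = cone_num i j n - quad_num i j n / 3"

text \<open>Coordinates on the half cone below the diagonal: the first one is measured from the line \<open>i = -1\<close>,
  on which the reduced numbers vanish for \<open>j < 0\<close>, the second one is the distance \<open>i - j\<close> from the diagonal.  In them
  the steps are those of Gessel's walks, with a reflecting instead of an absorbing diagonal.\<close>

definition wedge_num :: "nat \<Rightarrow> nat \<times> nat \<Rightarrow> real" where
  "wedge_num n p = reduced_num (int (fst p)) (int (fst p) - int (snd p)) n"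

lemma wedge_num_0: "wedge_num 0 (a, b) = (if a = 0 \<and> b = 0 then 2/3 else if a = 0 \<and> b = 2 then 1/3 else 0)"
  by (auto simp: wedge_num_def reduced_num_def cone_num_0 quad_num_0)

lemma wedge_num_Suc_diag: "wedge_num (Suc n) (a, 0) = 2 * wedge_num n (a + 1, 1) + 2 * wedge_num n (a, 1)"
  using cone_num_sym[of "int a" "int a + 1" n] cone_num_sym[of "int a" "int a - 1" n]
    quad_num_sym[of "int a" "int a + 1" n] quad_num_sym[of "int a" "int a - 1" n]
  by (simp add: wedge_num_def reduced_num_def cone_num_Suc quad_num_Suc field_simps)

lemma wedge_num_Suc:
  "wedge_num (Suc n) (a, Suc b) = wedge_num n (a + 1, b + 2) + (if a = 0 then 0 else wedge_num n (a - 1, b))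
     + wedge_num n (a, b) + wedge_num n (a, b + 2)"
proof -
  have "reduced_num (int a - 1) (int a - int (Suc b)) n = (if a = 0 then 0 else wedge_num n (a - 1, b))"
    by (auto simp: wedge_num_def reduced_num_def quad_num_axis cone_num_outside of_nat_diff algebra_simps)
  moreover have "wedge_num (Suc n) (a, Suc b) = wedge_num n (a + 1, b + 2) + reduced_num (int a - 1) (int a - int (Suc b)) n
     + wedge_num n (a, b) + wedge_num n (a, b + 2)"
    by (simp add: wedge_num_def reduced_num_def cone_num_Suc quad_num_Suc field_simps)
  ultimately show ?thesis by simp
qed

lemma wedge_num_finite: "finite {p. wedge_num n p \<noteq> 0}"
proof (rule finite_subset)
  show "{p. wedge_num n p \<noteq> 0} \<subseteq> {..n + 2} \<times> {..2 * n + 4}"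
  proof
    fix p assume "p \<in> {p. wedge_num n p \<noteq> 0}"
    then have nz: "cone_num (int (fst p)) (int (fst p) - int (snd p)) n \<noteq> 0 \<or>
      quad_num (int (fst p)) (int (fst p) - int (snd p)) n \<noteq> 0"
      by (auto simp: wedge_num_def reduced_num_def)
    have "\<bar>int (fst p)\<bar> \<le> int n + 2" "\<bar>int (fst p) - int (snd p)\<bar> \<le> int n + 2"
      using nz cone_num_far[of n "int (fst p)" "int (fst p) - int (snd p)"]
        quad_num_far[of n "int (fst p)" "int (fst p) - int (snd p)"] by linarith+
    then show "p \<in> {..n + 2} \<times> {..2 * n + 4}"
      by (cases p) auto
  qed
qed simp

definition bconst :: "real \<Rightarrow> bps" where "bconst c = fps_const (fps_const c)"

lemma bconst_add: "bconst (c + d) = bconst c + bconst d" by (simp add: bconst_def)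
lemma bconst_0 [simp]: "bconst 0 = 0" by (simp add: bconst_def)
lemma bconst_1 [simp]: "bconst 1 = 1" by (simp add: bconst_def)
lemma bconst_mult: "bconst (c * d) = bconst c * bconst d" by (simp add: bconst_def)
lemma bconst_numeral: "bconst (numeral k) = numeral k"
  unfolding bconst_def by (simp add: fps_numeral_fps_const)

definition peval :: "bps \<Rightarrow> bps \<Rightarrow> (nat \<times> nat \<Rightarrow> real) \<Rightarrow> bps" where
  "peval x y f = (\<Sum>p\<in>{p. f p \<noteq> 0}. bconst (f p) * x ^ fst p * y ^ snd p)"

lemma peval_superset:
  assumes "finite T" "{p. f p \<noteq> 0} \<subseteq> T"
  shows "peval x y f = (\<Sum>p\<in>T. bconst (f p) * x ^ fst p * y ^ snd p)"
  unfolding peval_def by (rule sum.mono_neutral_left) (use assms in auto)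

lemma peval_add:
  assumes "finite {p. f p \<noteq> 0}" "finite {p. g p \<noteq> 0}"
  shows "peval x y (\<lambda>p. f p + g p) = peval x y f + peval x y g"
proof -
  let ?T = "{p. f p \<noteq> 0} \<union> {p. g p \<noteq> 0}"
  have "peval x y (\<lambda>p. f p + g p) = (\<Sum>p\<in>?T. bconst (f p + g p) * x ^ fst p * y ^ snd p)"
    by (rule peval_superset) (use assms in auto)
  moreover have "peval x y f = (\<Sum>p\<in>?T. bconst (f p) * x ^ fst p * y ^ snd p)"
    by (rule peval_superset) (use assms in auto)
  moreover have "peval x y g = (\<Sum>p\<in>?T. bconst (g p) * x ^ fst p * y ^ snd p)"
    by (rule peval_superset) (use assms in auto)
  ultimately show ?thesis by (simp add: bconst_add distrib_right sum.distrib)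
qed

lemma peval_cmult: "c \<noteq> 0 \<Longrightarrow> peval x y (\<lambda>p. c * f p) = bconst c * peval x y f"
  by (simp add: peval_def bconst_mult sum_distrib_left mult_ac)

lemma peval_x: "x * peval x y f = peval x y (\<lambda>(a, b). if a = 0 then 0 else f (a - 1, b))"
  unfolding peval_def sum_distrib_left
  by (rule sum.reindex_bij_witness[of _ "\<lambda>(a, b). (a - 1, b)" "\<lambda>(a, b). (Suc a, b)"])
     (auto simp: mult_ac split: if_splits)

lemma peval_y: "y * peval x y f = peval x y (\<lambda>(a, b). if b = 0 then 0 else f (a, b - 1))"
  unfolding peval_def sum_distrib_left
  by (rule sum.reindex_bij_witness[of _ "\<lambda>(a, b). (a, b - 1)" "\<lambda>(a, b). (a, Suc b)"])
     (auto simp: mult_ac split: if_splits)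


abbreviation fin_supp :: "(nat \<times> nat \<Rightarrow> real) \<Rightarrow> bool" where
  "fin_supp f \<equiv> finite {p. f p \<noteq> 0}"

definition shift_x :: "(nat \<times> nat \<Rightarrow> real) \<Rightarrow> nat \<times> nat \<Rightarrow> real" where
  "shift_x f = (\<lambda>(a, b). if a = 0 then 0 else f (a - 1, b))"
definition shift_y :: "(nat \<times> nat \<Rightarrow> real) \<Rightarrow> nat \<times> nat \<Rightarrow> real" where
  "shift_y f = (\<lambda>(a, b). if b = 0 then 0 else f (a, b - 1))"

lemma fin_supp_shift [simp]:
  assumes "fin_supp f" shows "fin_supp (shift_x f)" "fin_supp (shift_y f)"
proof -
  have "{p. shift_x f p \<noteq> 0} \<subseteq> (\<lambda>(a, b). (Suc a, b)) ` {p. f p \<noteq> 0}"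
  proof
    fix p assume "p \<in> {p. shift_x f p \<noteq> 0}"
    then show "p \<in> (\<lambda>(a, b). (Suc a, b)) ` {p. f p \<noteq> 0}"
      by (cases p, cases "fst p") (auto simp: shift_x_def image_iff)
  qed
  then show "fin_supp (shift_x f)" using assms by (meson finite_imageI finite_subset)
  have "{p. shift_y f p \<noteq> 0} \<subseteq> (\<lambda>(a, b). (a, Suc b)) ` {p. f p \<noteq> 0}"
  proof
    fix p assume "p \<in> {p. shift_y f p \<noteq> 0}"
    then show "p \<in> (\<lambda>(a, b). (a, Suc b)) ` {p. f p \<noteq> 0}"
      by (cases p, cases "snd p") (auto simp: shift_y_def image_iff)
  qed
  then show "fin_supp (shift_y f)" using assms by (meson finite_imageI finite_subset)
qed

lemma fin_supp_add [simp]: "fin_supp f \<Longrightarrow> fin_supp g \<Longrightarrow> fin_supp (\<lambda>p. f p + g p)"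
  by (rule finite_subset[of _ "{p. f p \<noteq> 0} \<union> {p. g p \<noteq> 0}"]) auto

lemma fin_supp_cmult [simp]: "fin_supp f \<Longrightarrow> fin_supp (\<lambda>p. c * f p)"
  by (rule finite_subset[of _ "{p. f p \<noteq> 0}"]) auto

definition off_diag :: "nat \<Rightarrow> nat \<times> nat \<Rightarrow> real" where
  "off_diag n = (\<lambda>(a, b). if b = 0 then 0 else wedge_num n (a, b))"
definition on_diag :: "nat \<Rightarrow> nat \<times> nat \<Rightarrow> real" where
  "on_diag n = (\<lambda>(a, b). if b = 0 then wedge_num n (a, b) else 0)"
definition on_edge :: "nat \<Rightarrow> nat \<times> nat \<Rightarrow> real" where
  "on_edge n = (\<lambda>(a, b). if a = 0 \<and> b \<noteq> 0 then wedge_num n (a, b) else 0)"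

lemma fin_supp_parts [simp]: "fin_supp (off_diag n)" "fin_supp (on_diag n)" "fin_supp (on_edge n)"
  by (rule finite_subset[OF _ wedge_num_finite[of n]], clarify,
      simp add: off_diag_def on_diag_def on_edge_def split: if_splits)+

text \<open>The recurrence in a form without case distinctions: the contribution of the edge is added on the left,
  and the factor 2 in front of the other terms accounts for the doubling on the diagonal.\<close>

lemma coefficient_recurrence:
  fixes n defines "l \<equiv> off_diag n" and "d \<equiv> on_diag n"
  shows "2 * shift_x (shift_y (off_diag (Suc n))) p + shift_x (shift_y (on_diag (Suc n))) p + 2 * on_edge n p
    = 2 * l p + 2 * shift_x l p + 2 * shift_x (shift_y (shift_y l)) p
      + 2 * shift_x (shift_x (shift_y (shift_y l))) p
      + 2 * shift_x (shift_y (shift_y d)) p + 2 * shift_x (shift_x (shift_y (shift_y d))) p"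
proof -
  obtain a b where p: "p = (a, b)" by force
  consider "a = 0" | a' where "a = Suc a'" by (cases a)
  then show ?thesis
  proof cases
    case 1
    then show ?thesis by (auto simp: p l_def d_def shift_x_def shift_y_def off_diag_def on_edge_def)
  next
    case (2 a')
    consider "b = 0" | "b = 1" | b' where "b = Suc (Suc b')" by (cases b; cases "b - 1") auto
    then show ?thesis
    proof cases
      case (3 b')
      then show ?thesis using 2
        by (auto simp: p l_def d_def shift_x_def shift_y_def off_diag_def on_diag_def on_edge_def wedge_num_Suc)
    qed (use 2 in \<open>auto simp: p l_def d_def shift_x_def shift_y_def off_diag_def on_diag_def on_edge_def
          wedge_num_Suc_diag\<close>)
  qed
qed

lemma peval_shift: "peval x y (shift_x f) = x * peval x y f" "peval x y (shift_y f) = y * peval x y f"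
  by (simp_all add: peval_x peval_y shift_x_def shift_y_def)

lemma peval_recurrence:
  fixes x y :: bps
  shows "x * y * (2 * peval x y (off_diag (Suc n)) + peval x y (on_diag (Suc n))) =
    2 * (1 + x) * (1 + x * y\<^sup>2) * peval x y (off_diag n) - 2 * peval x y (on_edge n)
      + 2 * x * y\<^sup>2 * (1 + x) * peval x y (on_diag n)"
proof -
  define l d where "l = off_diag n" and "d = on_diag n"
  have two: "(2 :: real) \<noteq> 0" by simp
  have fin: "fin_supp l" "fin_supp d" by (simp_all add: l_def d_def)
  have "peval x y (\<lambda>p. 2 * shift_x (shift_y (off_diag (Suc n))) p
      + shift_x (shift_y (on_diag (Suc n))) p + 2 * on_edge n p)
    = peval x y (\<lambda>p. 2 * l p + 2 * shift_x l p + 2 * shift_x (shift_y (shift_y l)) p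
      + 2 * shift_x (shift_x (shift_y (shift_y l))) p
      + 2 * shift_x (shift_y (shift_y d)) p + 2 * shift_x (shift_x (shift_y (shift_y d))) p)"
    unfolding l_def d_def coefficient_recurrence ..
  then show ?thesis
    unfolding l_def[symmetric] d_def[symmetric]
    by (simp only: peval_add peval_cmult[OF two] peval_shift bconst_numeral fin fin_supp_add fin_supp_cmult
        fin_supp_shift fin_supp_parts) algebra
qed

lemma peval_initial:
  "6 * peval x y (off_diag 0) + 3 * peval x y (on_diag 0) = 2 * (1 + y\<^sup>2)"
proof -
  have "peval x y (off_diag 0) = (\<Sum>p\<in>{(0,2)}. bconst (off_diag 0 p) * x ^ fst p * y ^ snd p)"
    by (rule peval_superset) (auto simp: off_diag_def wedge_num_0 split: if_splits)
  moreover have "peval x y (on_diag 0) = (\<Sum>p\<in>{(0,0)}. bconst (on_diag 0 p) * x ^ fst p * y ^ snd p)"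
    by (rule peval_superset) (auto simp: on_diag_def wedge_num_0 split: if_splits)
  moreover have "6 * bconst (1/3) = 2" "3 * bconst (2/3) = 2"
    using bconst_mult[of 6 "1/3"] bconst_mult[of 3 "2/3"] by (simp_all add: bconst_numeral)
  moreover have "off_diag 0 (0, 2) = 1/3" "on_diag 0 (0, 0) = 2/3"
    by (simp_all add: off_diag_def on_diag_def wedge_num_0)
  ultimately have "6 * peval x y (off_diag 0) + 3 * peval x y (on_diag 0)
      = 6 * bconst (1/3) * y\<^sup>2 + 3 * bconst (2/3)"
    by simp
  then show ?thesis using \<open>6 * bconst (1/3) = 2\<close> \<open>3 * bconst (2/3) = 2\<close> by (simp add: distrib_left)
qed

definition genfun :: "bps \<Rightarrow> bps \<Rightarrow> (nat \<Rightarrow> nat \<times> nat \<Rightarrow> real) \<Rightarrow> bps" where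
  "genfun x y f = tsum (\<lambda>n. peval x y (f n))"

text \<open>The bulk series \<open>L\<close> enters with the factor \<open>x y - t (1 + x) (1 + x y\<^sup>2)\<close>, the kernel.\<close>

lemma functional_equation:
  fixes x y :: bps
  defines "L \<equiv> genfun x y off_diag" and "D \<equiv> genfun x y on_diag" and "B \<equiv> genfun x y on_edge"
  shows "x * y * (6 * L + 3 * D - 2 * (1 + y\<^sup>2)) =
    6 * bT * ((1 + x) * (1 + x * y\<^sup>2) * L - B + x * y\<^sup>2 * (1 + x) * D)"
proof -
  have step: "x * y * (6 * L + 3 * D) = tsum (\<lambda>n. x * y * (6 * peval x y (off_diag n) + 3 * peval x y (on_diag n)))"
    by (simp add: L_def D_def genfun_def tsum_mult tsum_add)
  also have "\<dots> = x * y * (2 * (1 + y\<^sup>2)) + bT * tsum (\<lambda>n. x * y *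
      (6 * peval x y (off_diag (Suc n)) + 3 * peval x y (on_diag (Suc n))))"
    by (subst tsum_step) (simp only: peval_initial)
  also have "(\<lambda>n. x * y * (6 * peval x y (off_diag (Suc n)) + 3 * peval x y (on_diag (Suc n)))) =
    (\<lambda>n. 6 * ((1 + x) * (1 + x * y\<^sup>2)) * peval x y (off_diag n) - 6 * peval x y (on_edge n)
      + 6 * (x * y\<^sup>2 * (1 + x)) * peval x y (on_diag n))"
  proof
    fix n
    have "x * y * (6 * peval x y (off_diag (Suc n)) + 3 * peval x y (on_diag (Suc n))) =
       3 * (x * y * (2 * peval x y (off_diag (Suc n)) + peval x y (on_diag (Suc n))))"
      by algebra
    then show "x * y * (6 * peval x y (off_diag (Suc n)) + 3 * peval x y (on_diag (Suc n))) =
      6 * ((1 + x) * (1 + x * y\<^sup>2)) * peval x y (off_diag n) - 6 * peval x y (on_edge n)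
      + 6 * (x * y\<^sup>2 * (1 + x)) * peval x y (on_diag n)"
      unfolding peval_recurrence by algebra
  qed
  also have "tsum \<dots> = 6 * ((1 + x) * (1 + x * y\<^sup>2)) * L - 6 * B + 6 * (x * y\<^sup>2 * (1 + x)) * D"
    by (simp add: L_def D_def B_def genfun_def tsum_mult tsum_add tsum_diff)
  finally show ?thesis by algebra
qed

lemma genfun_supp:
  assumes P: "additive_pred P" "bT \<in> supp P"
    and x: "\<And>n p. f n p \<noteq> 0 \<Longrightarrow> fst p = 0 \<or> x \<in> supp P"
    and y: "\<And>n p. f n p \<noteq> 0 \<Longrightarrow> snd p = 0 \<or> y \<in> supp P"
  shows "genfun x y f \<in> supp P"
  unfolding genfun_def
proof (intro supp_tsum P)
  fix n
  have "bconst (f n p) * x ^ fst p * y ^ snd p \<in> supp P" if "f n p \<noteq> 0" for p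
  proof -
    have "x ^ fst p \<in> supp P" using x[OF that] P(1) by (auto intro: supp_power)
    moreover have "y ^ snd p \<in> supp P" using y[OF that] P(1) by (auto intro: supp_power)
    ultimately show ?thesis unfolding bconst_def using P(1) by (intro supp_mult supp_const)
  qed
  then show "peval x y (f n) \<in> supp P"
    unfolding peval_def by (intro supp_sum P) auto
qed

lemma genfun_on_edge:
  assumes "y \<in> supp wside"
  obtains B' where "genfun x y on_edge = y * B'" "B' \<in> supp wside"
proof
  define f where "f n = (\<lambda>(a, b). on_edge n (a, Suc b))" for n
  have "on_edge n = shift_y (f n)" for n
    by (auto simp: fun_eq_iff on_edge_def shift_y_def f_def)
  then show "genfun x y on_edge = y * genfun x y f"
    by (simp add: genfun_def peval_shift tsum_mult)
  show "genfun x y f \<in> supp wside"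
    by (rule genfun_supp) (use assms in \<open>auto simp: f_def on_edge_def split: if_splits\<close>)
qed

lemma genfun_on_diag:
  assumes "x \<in> supp vside"
  obtains D' where "genfun x y on_diag = diag (Abs_fps (\<lambda>n. wedge_num n (0, 0))) + x * D'" "D' \<in> supp vside"
proof
  define f where "f n = (\<lambda>(a, b). on_diag n (Suc a, b))" for n
  define g :: "nat \<Rightarrow> nat \<times> nat \<Rightarrow> real" where "g n = (\<lambda>p. if p = (0, 0) then wedge_num n (0, 0) else 0)" for n
  have fg: "on_diag n = (\<lambda>p. g n p + shift_x (f n) p)" for n
    by (auto simp: fun_eq_iff on_diag_def shift_x_def f_def g_def)
  have "peval x y (g n) = (\<Sum>p\<in>{(0,0)}. bconst (g n p) * x ^ fst p * y ^ snd p)" for n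
    by (rule peval_superset) (auto simp: g_def split: if_splits)
  then have g: "peval x y (g n) = fps_const (fps_const (wedge_num n (0, 0)))" for n
    by (simp add: g_def bconst_def)
  have fin: "fin_supp (g n)" for n
    by (rule finite_subset[of _ "{(0,0)}"]) (auto simp: g_def split: if_splits)
  have "{p. f n p \<noteq> 0} \<subseteq> (\<lambda>(a, b). (a - 1, b)) ` {p. on_diag n p \<noteq> 0}" for n
  proof
    fix p assume "p \<in> {p. f n p \<noteq> 0}"
    then show "p \<in> (\<lambda>(a, b). (a - 1, b)) ` {p. on_diag n p \<noteq> 0}"
      by (intro image_eqI[of _ _ "(Suc (fst p), snd p)"]) (auto simp: f_def split: prod.splits)
  qed
  then have "fin_supp (f n)" for n by (rule finite_subset) simp
  then have "peval x y (on_diag n) = fps_const (fps_const (wedge_num n (0, 0))) + x * peval x y (f n)" for n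
    unfolding fg using fin by (simp add: peval_add peval_shift g)
  then show "genfun x y on_diag = diag (Abs_fps (\<lambda>n. wedge_num n (0, 0))) + x * genfun x y f"
    by (simp add: genfun_def tsum_mult tsum_add tsum_const)
  show "genfun x y f \<in> supp vside"
    by (rule genfun_supp) (use assms in \<open>auto simp: f_def on_diag_def split: if_splits\<close>)
qed

section \<open>The kernel curve\<close>

text \<open>On the kernel curve the rational functions \<open>Y/t - Y\<^sup>2\<close> with \<open>Y = y + 1/y\<close> and \<open>X - 4 + 1/(t\<^sup>2 X)\<close> with
  \<open>X = (1 + x)\<^sup>2/x\<close> agree.  Both are to be equal to one function of \<open>w = 1/W\<close> that has a double pole at
  infinity and a simple pole at 0.  Such a function \<open>R\<close> is fixed, up to a normalization of \<open>w\<close>, by its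
  critical values, namely \<open>1/(4 t\<^sup>2)\<close>, where \<open>Y\<close> ramifies, and \<open>\<plusminus>2/t - 4\<close>, where \<open>X\<close> ramifies.  With \<open>a = A/t\<close> and
  \<open>b = e/(2 t)\<close> the first condition reads \<open>1/(4 t\<^sup>2) - R(w) = (w - a) (w - b)\<^sup>2 / w\<close>, and the other two
  amount to the relations \<open>rel1\<close> and \<open>rel2\<close>.  The series \<open>\<alpha>\<close> and \<open>\<epsilon>\<close> record that \<open>A\<close> and \<open>e - 1\<close> are
  divisible by \<open>t\<^sup>2\<close> and \<open>t\<close>.\<close>

locale curve_parameters =
  fixes A e \<alpha> \<epsilon> :: "real fps"
  assumes A_eq: "A = fps_X\<^sup>2 * \<alpha>" and e_eq: "e = 1 + fps_X * \<epsilon>"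
    and rel1: "256 * fps_X\<^sup>2 = A * (A + 4 * e) ^ 3"
    and rel2: "2 * e\<^sup>2 + 10 * A * e - A\<^sup>2 = 2 + 32 * fps_X\<^sup>2"
begin

definition "half = bconst (1/2)"
abbreviation "dA \<equiv> diag A"
abbreviation "dE \<equiv> diag e"

lemma half: "2 * half = 1"
  using bconst_mult[of 2 "1/2"] by (simp add: bconst_numeral half_def)

lemma const0_half [simp]: "const0 half = 1/2"
  by (simp add: half_def bconst_def)

lemma const0_numeral [simp]: "const0 (numeral k) = numeral k"
  by (simp add: fps_numeral_nth)

lemma half_supp [simp]: "additive_pred P \<Longrightarrow> half \<in> supp P"
  by (simp add: half_def bconst_def)

lemma dA_eq: "dA = bT\<^sup>2 * diag \<alpha>"
  by (simp add: A_eq)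
lemma dE_eq: "dE = 1 + bT * diag \<epsilon>"
  by (simp add: e_eq)

lemma drel1: "256 * bT\<^sup>2 = dA * (dA + 4 * dE) ^ 3"
  using arg_cong[OF rel1, of diag] by simp
lemma drel2: "2 * dE\<^sup>2 + 10 * dA * dE - dA\<^sup>2 = 2 + 32 * bT\<^sup>2"
  using arg_cong[OF rel2, of diag] by simp

lemma const0_dE [simp]: "fps_nth e 0 = 1" by (simp add: e_eq)
lemma const0_dA [simp]: "fps_nth A 0 = 0" by (simp add: A_eq)

text \<open>The side of \<open>y\<close>.  Here \<open>rho\<close> is the square root of \<open>1 - a/w\<close>, so that \<open>Y = 1/(2 t) + (w - b) rho\<close>; the
  series \<open>Yh\<close> is \<open>W Y\<close>, written in such a way that no division by \<open>t\<close> remains, and \<open>y\<close> is the root of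
  \<open>y + 1/y = Y\<close> that is divisible by \<open>W\<close>.\<close>

definition "rho = bsqrt (1 - bT * diag \<alpha> * bW)"
definition "Yh = rho + half * bW * (diag \<alpha> * bW * inverse (1 + rho) - diag \<epsilon> * rho)"
definition "kap = 2 * inverse (Yh + bsqrt (Yh\<^sup>2 - 4 * bW\<^sup>2))"
definition "y = bW * kap"

lemma rho: "rho\<^sup>2 = 1 - bT * diag \<alpha> * bW" "const0 rho = 1"
  using bsqrt[of "1 - bT * diag \<alpha> * bW"] by (simp_all add: rho_def power2_eq_square del: fps_mult_nth_0)

lemma rho_supp [simp]: "rho \<in> supp wside"
  unfolding rho_def by (intro supp_bsqrt supp_intros) (simp_all del: fps_mult_nth_0)

lemma const0_1rho: "const0 (1 + rho) = 2" using rho by simp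

lemma one_minus_rho: "1 - rho = bT * diag \<alpha> * bW * inverse (1 + rho)"
proof -
  have "(1 + rho) * inverse (1 + rho) = 1" by (rule bps_inverse) (unfold const0_1rho, simp)
  then show ?thesis using rho(1) by algebra
qed

lemma const0_Yh: "const0 Yh = 1"
  unfolding Yh_def using rho(2) by (simp del: fps_mult_nth_0)

lemma Yh_supp [simp]: "Yh \<in> supp wside"
  unfolding Yh_def by (intro supp_intros supp_inverse) (simp_all add: const0_1rho del: fps_add_nth)

lemma Yh: "2 * bV * Yh = 1 + (2 * bV - dE) * rho"
  using half one_minus_rho dE_eq unfolding Yh_def bT_def by algebra

lemma kap: "1 + bW\<^sup>2 * kap\<^sup>2 = Yh * kap" "const0 kap = 1" "kap \<in> supp wside"
proof -
  let ?f = "Yh\<^sup>2 - 4 * bW\<^sup>2" 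
  let ?d = "Yh + bsqrt ?f"
  have c: "const0 ?f = 1" using const0_Yh by (simp del: fps_mult_nth_0)
  have s: "bsqrt ?f * bsqrt ?f = ?f" "const0 (bsqrt ?f) = 1" using bsqrt[OF c] by auto
  have cd: "const0 ?d = 2" using s const0_Yh by simp
  have "?d * inverse ?d = 1" by (rule bps_inverse) (unfold cd, simp)
  then have kd: "kap * ?d = 2" unfolding kap_def by algebra
  have "4 * (1 + bW\<^sup>2 * kap\<^sup>2 - Yh * kap) = 0" using s(1) kd by algebra
  then have "1 + bW\<^sup>2 * kap\<^sup>2 - Yh * kap = 0" by (simp only: mult_eq_0_iff) simp
  then show "1 + bW\<^sup>2 * kap\<^sup>2 = Yh * kap" by simp
  show "const0 kap = 1" unfolding kap_def using cd by (simp del: fps_add_nth)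
  have "?f \<in> supp wside" by (intro supp_intros) simp_all
  then have "bsqrt ?f \<in> supp wside" using c by (intro supp_bsqrt) simp_all
  then show "kap \<in> supp wside" unfolding kap_def
    by (intro supp_intros supp_inverse) (simp_all add: cd del: fps_add_nth)
qed

lemma y: "bT * (1 + y\<^sup>2) = bV * Yh * y" "y \<in> supp wside" "y \<noteq> 0"
proof -
  show "bT * (1 + y\<^sup>2) = bV * Yh * y" using kap(1) unfolding y_def bT_def by algebra
  show "y \<in> supp wside" unfolding y_def by (intro supp_intros kap) simp_all
  have "kap \<noteq> 0" using kap(2) by auto
  then show "y \<noteq> 0" by (simp add: y_def bW_def)
qed

text \<open>The side of \<open>x\<close>.  The quadratic equation \<open>X - 4 + 1/(t\<^sup>2 X) = R(w)\<close> has a discriminant with two double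
  roots, which leaves the square root \<open>S\<close> of a quadratic polynomial.  The series \<open>chi\<close> is \<open>1/X\<close>; in
  the formula \<open>16 V chi = N + (8 V\<^sup>2 - 4 A V - 2 A e) S\<close> the right-hand side is divisible by \<open>V\<^sup>2\<close>, and
  \<open>S1\<close> and \<open>S2\<close> are the quotients that occur when these two factors are removed one at a time.  Finally
  \<open>theta\<close> is \<open>(1 - x)/(1 + x)\<close>.\<close>

definition "S = bsqrt ((dE - bV)\<^sup>2 - dA * bV)"
definition "S1 = (2 * dE + dA - bV) * inverse (dE + S)"
definition "S2 = ((2 * dE + dA) * S1 - 2 * dE) * half * inverse dE * inverse (dE + S)"
definition "chi1 = half * (- bV + dA + 2 * dE - S1 * (bV - half * dA) + half * half * S2 * dA * dE)"
definition "chi = bV * chi1"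
definition "theta = bsqrt (1 - 4 * chi)"
definition "lam = 4 * chi1 * inverse ((1 + theta)\<^sup>2)"
definition "x = bV * lam"
definition "N = - 8 * bV ^ 3 + 8 * (dA + dE) * bV\<^sup>2 + (2 * dA * dE - dA\<^sup>2) * bV + 2 * dA * dE\<^sup>2"

lemma S: "S\<^sup>2 = (dE - bV)\<^sup>2 - dA * bV" "const0 S = 1" "S \<in> supp vside"
proof -
  have c: "const0 ((dE - bV)\<^sup>2 - dA * bV) = 1" by (simp del: fps_mult_nth_0)
  show "S\<^sup>2 = (dE - bV)\<^sup>2 - dA * bV" "const0 S = 1"
    using bsqrt[OF c] by (simp_all add: S_def power2_eq_square)
  show "S \<in> supp vside" unfolding S_def by (intro supp_bsqrt supp_intros c) simp_all
qed

lemma const0_ES: "const0 (dE + S) = 2" using S by simp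

lemma S1: "S = dE - bV * S1" "const0 S1 = 1" "S1 \<in> supp vside"
proof -
  have "(dE + S) * inverse (dE + S) = 1" by (rule bps_inverse) (unfold const0_ES, simp)
  then show "S = dE - bV * S1" using S(1) unfolding S1_def by algebra
  have c: "const0 (2 * dE + dA - bV) = 2"
    by (simp only: fps_add_nth fps_sub_nth const0_mult const0_numeral const0_diag const0_dE const0_dA const0_simps)
  show "const0 S1 = 1"
    using const0_inverse[of "dE + S"] by (simp only: S1_def const0_mult c const0_ES) simp
  show "S1 \<in> supp vside" unfolding S1_def
    by (intro supp_intros supp_inverse S) (simp_all add: const0_ES del: fps_add_nth)
qed

lemma S2: "2 * dE * S1 = 2 * dE + dA + 2 * dE * bV * S2" "S2 \<in> supp vside"
proof -
  have i1: "(dE + S) * inverse (dE + S) = 1" by (rule bps_inverse) (unfold const0_ES, simp)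
  have i2: "dE * inverse dE = 1" by (rule bps_inverse) simp
  have "2 * dE * bV * S2 = bV * ((2 * dE + dA) * S1 - 2 * dE) * inverse (dE + S)"
    using i2 half unfolding S2_def by algebra
  also have "bV * S1 = dE - S" using S1(1) by simp
  then have "bV * ((2 * dE + dA) * S1 - 2 * dE) = (2 * dE + dA) * (dE - S) - 2 * dE * bV" by algebra
  also have "\<dots> * inverse (dE + S) = 2 * dE * S1 - (2 * dE + dA)"
    using i1 unfolding S1_def by algebra
  finally show "2 * dE * S1 = 2 * dE + dA + 2 * dE * bV * S2" by algebra
  show "S2 \<in> supp vside" unfolding S2_def
    by (intro supp_intros supp_inverse S S1) (simp_all add: const0_ES del: fps_add_nth)
qed

lemma chi1: "const0 chi1 = 1" "chi1 \<in> supp vside"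
proof -
  show "const0 chi1 = 1"
    unfolding chi1_def using S1(2) by (simp del: fps_mult_nth_0)
  show "chi1 \<in> supp vside" unfolding chi1_def
    by (intro supp_intros S1 S2) simp_all
qed

lemma chi_N: "16 * bV * chi = N + (8 * bV\<^sup>2 - 4 * dA * bV - 2 * dA * dE) * S"
proof -
  have "2 * chi1 = - bV + dA + 2 * dE - S1 * (bV - half * dA) + half * half * S2 * dA * dE"
    using half unfolding chi1_def by algebra
  then have "8 * chi1 = - 4 * bV + 4 * dA + 8 * dE - S1 * (4 * bV - 2 * dA) + S2 * dA * dE"
    using half by algebra
  then have "16 * bV * chi = 2 * bV * (bV * (- 4 * bV + 4 * dA + 8 * dE - S1 * (4 * bV - 2 * dA)) + dA * (dE * bV * S2))"
    unfolding chi_def by algebra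
  moreover have "2 * (dE * bV * S2) = 2 * dE * S1 - 2 * dE - dA" using S2(1) by algebra
  ultimately have "16 * bV * chi = 2 * bV * (bV * (- 4 * bV + 4 * dA + 8 * dE - S1 * (4 * bV - 2 * dA)))
     + dA * bV * (2 * dE * S1 - 2 * dE - dA)" by algebra
  then show ?thesis unfolding S1(1) N_def by algebra
qed

text \<open>The equation \<open>X - 4 + 1/(t\<^sup>2 X) = R(w)\<close> in terms of \<open>chi = 1/X\<close>; the polynomial \<open>N\<close> is
  \<open>8 t\<^sup>3 w (R(w) + 4)\<close>.  The identity between the discriminants is where the first relation enters.\<close>

lemma chi_quadratic: "8 * bV * chi\<^sup>2 - chi * N + 8 * bT\<^sup>2 * bV = 0"
proof -
  let ?G = "8 * bV\<^sup>2 - 4 * dA * bV - 2 * dA * dE"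
  have "N\<^sup>2 - ?G\<^sup>2 * ((dE - bV)\<^sup>2 - dA * bV) = dA * (dA + 4 * dE) ^ 3 * bV\<^sup>2"
    unfolding N_def by algebra
  then have "N\<^sup>2 - ?G\<^sup>2 * S\<^sup>2 = 256 * bT\<^sup>2 * bV\<^sup>2" using S(1) drel1 by algebra
  moreover have "(16 * bV * chi - N)\<^sup>2 = ?G\<^sup>2 * S\<^sup>2" using chi_N by algebra
  ultimately have "32 * bV * (8 * bV * chi\<^sup>2 - chi * N + 8 * bT\<^sup>2 * bV) = 0" by algebra
  then show ?thesis by (simp add: bV_def)
qed

lemma theta: "theta\<^sup>2 = 1 - 4 * chi" "const0 theta = 1" "theta \<in> supp vside"
proof -
  have c: "const0 (1 - 4 * chi) = 1" unfolding chi_def by (simp del: fps_mult_nth_0)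
  show "theta\<^sup>2 = 1 - 4 * chi" "const0 theta = 1"
    using bsqrt[OF c] by (simp_all add: theta_def power2_eq_square)
  show "theta \<in> supp vside" unfolding theta_def
    by (intro supp_bsqrt c) (auto simp: chi_def intro!: supp_intros chi1)
qed

lemma const0_theta2: "const0 ((1 + theta)\<^sup>2) = 4"
  unfolding const0_power using theta(2) by simp

lemma lam: "const0 lam = 1" "lam \<in> supp vside"
proof -
  show "const0 lam = 1" unfolding lam_def using const0_theta2 chi1(1) by (simp del: fps_mult_nth_0 const0_power)
  show "lam \<in> supp vside" unfolding lam_def
    by (intro supp_intros supp_inverse chi1 theta) (simp_all add: const0_theta2 del: const0_power)
qed

lemma x: "chi * (1 + x)\<^sup>2 = x" "chi1 * (1 + x)\<^sup>2 = lam" "x \<in> supp vside" "const0 x = 0"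
proof -
  have i: "(1 + theta)\<^sup>2 * inverse ((1 + theta)\<^sup>2) = 1"
    by (rule bps_inverse) (simp add: const0_theta2 del: const0_power)
  have nz: "1 + theta \<noteq> 0"
  proof
    assume "1 + theta = 0"
    with const0_theta2 show False by simp
  qed
  have l: "lam * (1 + theta)\<^sup>2 = 4 * chi1" using i unfolding lam_def by algebra
  then have "x * (1 + theta)\<^sup>2 = 4 * chi" unfolding x_def chi_def by algebra
  then have "(1 + theta) * (x * (1 + theta) - (1 - theta)) = 0" using theta(1) by algebra
  then have x1: "x * (1 + theta) = 1 - theta" using nz by simp
  have "(1 + theta)\<^sup>2 * (chi1 * (1 + x)\<^sup>2 - lam) = 0" using l x1 by algebra
  then show c: "chi1 * (1 + x)\<^sup>2 = lam" using nz by simp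
  then have "bV * (chi1 * (1 + x)\<^sup>2) = bV * lam" by simp
  then show "chi * (1 + x)\<^sup>2 = x" by (simp add: chi_def x_def mult.assoc)
  show "x \<in> supp vside" unfolding x_def by (intro supp_intros lam) simp_all
  show "const0 x = 0" unfolding x_def by (simp del: fps_mult_nth_0)
qed

lemma V_nonzero [simp]: "bV \<noteq> 0" "bW \<noteq> 0" "bT \<noteq> 0"
  by (simp_all add: bV_def bW_def bT_def)

text \<open>Since \<open>V Yh = t Y\<close>, this is the equality \<open>X - 4 + 1/(t\<^sup>2 X) = Y/t - Y\<^sup>2\<close>, multiplied by \<open>t\<^sup>2/X\<close>.\<close>

lemma invariants_agree:
  "chi\<^sup>2 + bT\<^sup>2 * (1 - 4 * chi) = chi * (bV * Yh) * (1 - bV * Yh)"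
proof -
  have "bV * rho\<^sup>2 = bV - dA" using rho(1) dA_eq unfolding bT_def by algebra
  then have "4 * bV * ((bV * Yh) * (1 - bV * Yh)) = bV - (2 * bV - dE)\<^sup>2 * (bV - dA)"
    using Yh by algebra
  then have "8 * bV * ((bV * Yh) * (1 - bV * Yh)) = N - 32 * bT\<^sup>2 * bV"
    using drel2 unfolding N_def by algebra
  then have "8 * bV * (chi\<^sup>2 + bT\<^sup>2 * (1 - 4 * chi) - chi * (bV * Yh) * (1 - bV * Yh)) = 0"
    using chi_quadratic by algebra
  then show ?thesis by simp
qed

text \<open>The two invariants agree on two curves, the kernel curve and its image under \<open>y \<mapsto> 1/y\<close>.  The constant
  terms rule out the second one.\<close>

lemma kernel: "x * y = bT * ((1 + x) * (1 + x * y\<^sup>2))"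
proof -
  let ?G = "x * y - bT * ((1 + x) * (1 + x * y\<^sup>2))"
  let ?H = "x * y - bT * ((1 + x) * (x + y\<^sup>2))"
  define u p where "u = bV * Yh" and "p = (1 + x)\<^sup>2"
  have uy: "bT * (1 + y\<^sup>2) = u * y" using y(1) by (simp add: u_def)
  have xp: "x = chi * p" using x(1) by (simp add: p_def)
  have inv: "chi\<^sup>2 + bT\<^sup>2 * (1 - 4 * chi) = chi * u * (1 - u)"
    using invariants_agree by (simp add: u_def)
  have "?G * ?H = x\<^sup>2 * y\<^sup>2 - x * y * p * (bT * (1 + y\<^sup>2))
     + p * (x * (bT * (1 + y\<^sup>2))\<^sup>2 + bT\<^sup>2 * y\<^sup>2 * (p - 4 * x))"
    unfolding p_def by algebra
  also have "\<dots> = y\<^sup>2 * p\<^sup>2 * (chi\<^sup>2 - u * chi + u\<^sup>2 * chi - 4 * bT\<^sup>2 * chi + bT\<^sup>2)"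
    unfolding uy using xp by algebra
  also have "\<dots> = 0" using inv by algebra
  finally have GH: "?G * ?H = 0" .
  have "?H = bT * (lam * kap - (1 + x) * (x + y\<^sup>2))"
    by (simp add: x_def y_def bT_def algebra_simps)
  moreover have "const0 (lam * kap - (1 + x) * (x + y\<^sup>2)) = 1"
    using lam kap x(4) by (simp add: y_def del: fps_mult_nth_0)
  then have "lam * kap - (1 + x) * (x + y\<^sup>2) \<noteq> 0" by force
  ultimately have "?H \<noteq> 0" by simp
  then show ?thesis using GH by simp
qed

text \<open>On the curve, \<open>delta\<close> is the difference of the two branches \<open>y\<close> and \<open>1/(x y)\<close> of the kernel over the
  same \<open>x\<close>, up to the factor \<open>t (1 + x)\<close>.  It mixes \<open>x\<close> and \<open>y\<close>, but its product with \<open>(1 - x)/(1 + x)\<close>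
  is \<open>rho\<close> times a polynomial in \<open>V\<close>.\<close>

definition "delta = 2 * bT * y * (1 + x) - 1"

lemma delta: "delta * (1 - x) = (2 * bV - dE) * rho * (1 + x)"
proof -
  have "y * (delta * (1 - x) - (2 * (bV * Yh) - 1) * (1 + x)) = 0"
    using kernel y(1) unfolding delta_def by algebra
  then have "delta * (1 - x) = (2 * (bV * Yh) - 1) * (1 + x)" using y(3) by simp
  then show ?thesis using Yh by algebra
qed

text \<open>The rational term of \<open>core\<close> is the particular solution of the linear equation on the curve: the inhomogeneous
  term \<open>2 x (1 + y\<^sup>2)/3\<close> is a function of \<open>y\<close> plus \<open>delta\<close> times a function of \<open>x\<close>, with poles at
  \<open>y = 0\<close> and \<open>x = -1\<close> (\<open>polar_part\<close>).\<close>

definition "D = genfun x y on_diag"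
definition "ix = inverse (1 - x)"
definition "jx = inverse ((1 + x)\<^sup>2)"
definition "core = 6 * bT\<^sup>2 * x * D + (1 + 4 * x - x\<^sup>2) * jx"
definition "Q = (2 * bV - dE) * (1 + x) * ix * core"

lemma ix: "(1 - x) * ix = 1" "ix \<in> supp vside"
proof -
  have c: "const0 (1 - x) = 1" using x(4) by simp
  show "(1 - x) * ix = 1" unfolding ix_def by (rule bps_inverse) (unfold c, simp)
  show "ix \<in> supp vside" unfolding ix_def
    by (intro supp_inverse supp_intros x) (unfold c, simp_all)
qed

lemma jx: "(1 + x)\<^sup>2 * jx = 1" "jx \<in> supp vside"
proof -
  have c: "const0 ((1 + x)\<^sup>2) = 1" unfolding const0_power using x(4) by simp
  show "(1 + x)\<^sup>2 * jx = 1" unfolding jx_def by (rule bps_inverse) (unfold c, simp)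
  show "jx \<in> supp vside" unfolding jx_def
    by (intro supp_inverse supp_intros x) (unfold c, simp_all)
qed

lemma edge_eq:
  assumes B: "genfun x y on_edge = y * B"
  shows "6 * bT * B = 2 * x * (1 + y\<^sup>2) + 3 * x * delta * D"
proof -
  have "x * y * (6 * genfun x y off_diag + 3 * D - 2 * (1 + y\<^sup>2)) =
    6 * bT * ((1 + x) * (1 + x * y\<^sup>2) * genfun x y off_diag - y * B + x * y\<^sup>2 * (1 + x) * D)"
    using functional_equation[of x y] B by (simp add: D_def)
  then have "y * (6 * bT * B - (2 * x * (1 + y\<^sup>2) + 3 * x * delta * D)) = 0"
    using kernel unfolding delta_def by algebra
  then show ?thesis using y(3) by simp
qed

lemma polar_part:
  "4 * bT\<^sup>2 * x * y\<^sup>2 * (1 + y\<^sup>2) + 4 * bT\<^sup>2 - 2 * bT * y + 4 * bT\<^sup>2 * y\<^sup>2 - y\<^sup>2 + 2 * bT * y ^ 3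
    = y\<^sup>2 * delta * ((1 + 4 * x - x\<^sup>2) * jx)"
proof -
  define q where "q = 1 + x * y\<^sup>2"
  define w where "w = bT * ((1 + x) * q)"
  have w: "w = x * y" using kernel by (simp add: w_def q_def)
  have qd: "q * delta = x * y\<^sup>2 - 1" using w unfolding delta_def w_def q_def by algebra
  have "(1 + x)\<^sup>2 * q\<^sup>2 * (4 * bT\<^sup>2 * x * y\<^sup>2 * (1 + y\<^sup>2) + 4 * bT\<^sup>2 - 2 * bT * y + 4 * bT\<^sup>2 * y\<^sup>2 - y\<^sup>2 + 2 * bT * y ^ 3)
    = 4 * w\<^sup>2 * (1 + y\<^sup>2) * q - 2 * y * (1 - y\<^sup>2) * (1 + x) * q * w - y\<^sup>2 * (1 + x)\<^sup>2 * q\<^sup>2"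
    unfolding w_def q_def by algebra
  also have "\<dots> = q * (y\<^sup>2 * ((x * y\<^sup>2 - 1) * (1 + 4 * x - x\<^sup>2)))"
    unfolding w q_def by algebra
  also have "\<dots> = (1 + x)\<^sup>2 * q\<^sup>2 * (y\<^sup>2 * delta * ((1 + 4 * x - x\<^sup>2) * jx))"
    using jx(1) qd by algebra
  finally have *: "(1 + x)\<^sup>2 * q\<^sup>2 * (4 * bT\<^sup>2 * x * y\<^sup>2 * (1 + y\<^sup>2) + 4 * bT\<^sup>2 - 2 * bT * y + 4 * bT\<^sup>2 * y\<^sup>2 - y\<^sup>2 + 2 * bT * y ^ 3)
    = (1 + x)\<^sup>2 * q\<^sup>2 * (y\<^sup>2 * delta * ((1 + 4 * x - x\<^sup>2) * jx))" .
  have "const0 ((1 + x)\<^sup>2 * q\<^sup>2) = 1"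
    unfolding const0_mult const0_power q_def using x(4) by (simp del: fps_mult_nth_0 add: y_def)
  then have "(1 + x)\<^sup>2 * q\<^sup>2 \<noteq> 0" by force
  with * show ?thesis by (metis (no_types, lifting) mult_left_cancel)
qed

text \<open>The left-hand side depends on \<open>y\<close> only, as \<open>ik = W/y\<close>, and \<open>Q\<close> depends on \<open>x\<close> only.  The two steps that
  make this possible are the splitting of the inhomogeneous term and the factorization of \<open>delta\<close>.\<close>

lemma uniformized:
  assumes B: "genfun x y on_edge = y * B"
  defines "ik \<equiv> Yh - bW\<^sup>2 * kap"
  shows "12 * bT ^ 3 * bW\<^sup>2 * B + 4 * bT\<^sup>2 * ik\<^sup>2 - 2 * bT * bW * ik + 4 * bT\<^sup>2 * bW\<^sup>2 - bW\<^sup>2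
     + 2 * bT * bW ^ 3 * kap = rho * (bW\<^sup>2 * Q)" (is "?P = _")
proof -
  have ik: "ik * kap = 1" using kap(1) unfolding ik_def by algebra
  then have iy: "ik * y = bW" unfolding y_def by algebra
  have ny: "(1 + x) * ix * (1 - x) = 1 + x" using ix(1) by algebra
  have "y\<^sup>2 * ?P = bW\<^sup>2 * (y\<^sup>2 * (2 * bT\<^sup>2 * (6 * bT * B)) + 4 * bT\<^sup>2 - 2 * bT * y + 4 * bT\<^sup>2 * y\<^sup>2 - y\<^sup>2 + 2 * bT * y ^ 3)"
  proof -
    have "y\<^sup>2 * ik\<^sup>2 = bW\<^sup>2" "y\<^sup>2 * (bW * ik) = bW\<^sup>2 * y" "bW ^ 3 * kap = bW\<^sup>2 * y"
    proof -
      show "y\<^sup>2 * ik\<^sup>2 = bW\<^sup>2" unfolding iy[symmetric] by algebra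
      show "y\<^sup>2 * (bW * ik) = bW\<^sup>2 * y" unfolding iy[symmetric] by algebra
      show "bW ^ 3 * kap = bW\<^sup>2 * y" by (simp add: y_def power2_eq_square power3_eq_cube)
    qed
    then show ?thesis by algebra
  qed
  also have "\<dots> = bW\<^sup>2 * (y\<^sup>2 * (6 * bT\<^sup>2 * x * delta * D) + y\<^sup>2 * delta * ((1 + 4 * x - x\<^sup>2) * jx))"
    unfolding edge_eq[OF B] polar_part[symmetric] by algebra
  also have "\<dots> = bW\<^sup>2 * y\<^sup>2 * (delta * core)" unfolding core_def by algebra
  also have "delta * core = rho * Q"
    using delta ix(1) unfolding Q_def by algebra
  finally have "y\<^sup>2 * ?P = y\<^sup>2 * (rho * (bW\<^sup>2 * Q))" by algebra
  moreover have "y\<^sup>2 \<noteq> 0" using y(3) by simp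
  ultimately show ?thesis by (metis (no_types, lifting) mult_left_cancel)
qed

lemma rho_expansion:
  obtains r where "rho = 1 - bW * (half * bT * diag \<alpha>) - bW\<^sup>2 * r" "r \<in> supp wside"
proof
  define s where "s = bT * diag \<alpha> * inverse (1 + rho)"
  have i: "(1 + rho) * inverse (1 + rho) = 1" by (rule bps_inverse) (unfold const0_1rho, simp)
  have r: "rho = 1 - bW * s" using one_minus_rho unfolding s_def by algebra
  have "s * (1 + rho) = bT * diag \<alpha>" using i unfolding s_def by algebra
  then have "2 * s = bT * diag \<alpha> + bW * s\<^sup>2" using r by algebra
  then have "s = half * bT * diag \<alpha> + bW * (half * s\<^sup>2)" using half by algebra
  then show "rho = 1 - bW * (half * bT * diag \<alpha>) - bW\<^sup>2 * (half * s\<^sup>2)" using r by algebra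
  show "half * s\<^sup>2 \<in> supp wside" unfolding s_def
    by (intro supp_intros supp_inverse) (simp_all add: const0_1rho del: fps_add_nth)
qed

lemma core_expansion:
  obtains d where "core = 1 + x * (2 + 6 * bT\<^sup>2 * diag (Abs_fps (\<lambda>n. wedge_num n (0, 0)))) + x\<^sup>2 * d"
    "d \<in> supp vside"
proof -
  from genfun_on_diag[OF x(3), of y] obtain D'
    where D': "D = diag (Abs_fps (\<lambda>n. wedge_num n (0, 0))) + x * D'" "D' \<in> supp vside"
    unfolding D_def by blast
  show ?thesis
  proof
    show "core = 1 + x * (2 + 6 * bT\<^sup>2 * diag (Abs_fps (\<lambda>n. wedge_num n (0, 0))))
        + x\<^sup>2 * (6 * bT\<^sup>2 * D' - (6 + 2 * x) * jx)"
      unfolding core_def D'(1) using jx(1) by algebra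
    show "6 * bT\<^sup>2 * D' - (6 + 2 * x) * jx \<in> supp vside"
      by (intro supp_intros D' x jx) simp_all
  qed
qed

lemma lam_expansion:
  obtains l0 m where "lam = diag l0 + bV * m" "m \<in> supp vside" "A * e\<^sup>2 * l0 = 4 * fps_X\<^sup>2"
proof -
  from vside_decomp[OF lam(2)] obtain l0 m where l: "lam = diag l0 + bV * m" "m \<in> supp vside" .
  define n where "n = - 8 * bV\<^sup>2 + 8 * (dA + dE) * bV + (2 * dA * dE - dA\<^sup>2)"
  have N: "N = 2 * dA * dE\<^sup>2 + bV * n" unfolding N_def n_def by algebra
  have "bV * (8 * bV\<^sup>2 * chi1\<^sup>2 - chi1 * N + 8 * bT\<^sup>2) = 0"
    using chi_quadratic unfolding chi_def by algebra
  then have "8 * bV\<^sup>2 * chi1\<^sup>2 - chi1 * N + 8 * bT\<^sup>2 = 0" by simp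
  then have c: "2 * dA * dE\<^sup>2 * chi1 = 8 * bT\<^sup>2 + bV * (8 * bV * chi1\<^sup>2 - chi1 * n)"
    unfolding N by algebra
  define h where "h = 8 * bV * chi1\<^sup>2 - chi1 * n + lam * (2 + x) * (2 * dA * dE\<^sup>2 * chi1)"
  have "chi1 * (1 + x)\<^sup>2 = chi1 + x * (2 + x) * chi1" by algebra
  then have "lam = chi1 + bV * lam * (2 + x) * chi1" unfolding x(2) by (simp only: x_def)
  then have "2 * dA * dE\<^sup>2 * lam = 8 * bT\<^sup>2 + bV * h" unfolding h_def using c by algebra
  moreover have "2 * dA * dE\<^sup>2 * lam = diag (2 * A * e\<^sup>2 * l0) + bV * (2 * dA * dE\<^sup>2 * m)"
    unfolding l(1) by (simp add: algebra_simps)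
  ultimately have "diag (2 * A * e\<^sup>2 * l0) + bV * (2 * dA * dE\<^sup>2 * m) = diag (8 * fps_X\<^sup>2) + bV * h" by simp
  moreover have "h \<in> supp vside" unfolding h_def n_def
    by (intro supp_intros chi1 lam x) simp_all
  moreover have "2 * dA * dE\<^sup>2 * m \<in> supp vside" by (intro supp_intros l) simp_all
  ultimately have "2 * A * e\<^sup>2 * l0 = 8 * fps_X\<^sup>2" using vside_decomp_unique by blast
  then have "2 * (A * e\<^sup>2 * l0) = 2 * (4 * fps_X\<^sup>2)" by (simp add: mult_ac)
  then have "A * e\<^sup>2 * l0 = 4 * fps_X\<^sup>2" by (simp only: mult_cancel_left) simp
  with l show ?thesis by (rule that)
qed

text \<open>The quadratic polynomial \<open>Q = q0 + q1 V + q2 V\<^sup>2\<close> has its coefficient \<open>q1\<close> determined twice.  Near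
  \<open>y = 0\<close> it involves the polar part only, since \<open>B(y)\<close> is divisible by \<open>y\<close>.  Near \<open>x = 0\<close> it involves
  the value of \<open>D\<close> at \<open>x = 0\<close>, which is the generating function of the reduced numbers at the origin.\<close>

lemma diagonal_series:
  "12 * fps_X ^ 4 * Abs_fps (\<lambda>n. wedge_num n (0, 0)) + 8 * fps_X\<^sup>2 = A * e * (2 * e + A)"
proof -
  define d0 where "d0 = Abs_fps (\<lambda>n. wedge_num n (0, 0))"
  from core_expansion obtain d where d: "core = 1 + x * (2 + 6 * bT\<^sup>2 * diag d0) + x\<^sup>2 * d" "d \<in> supp vside"
    unfolding d0_def .
  from genfun_on_edge[OF y(2), of x] obtain B where B: "genfun x y on_edge = y * B" "B \<in> supp wside" .
  from rho_expansion obtain r where r: "rho = 1 - bW * (half * bT * diag \<alpha>) - bW\<^sup>2 * r" "r \<in> supp wside" .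
  from lam_expansion obtain l0 m where l: "lam = diag l0 + bV * m" "m \<in> supp vside"
    "A * e\<^sup>2 * l0 = 4 * fps_X\<^sup>2" .
  define ik where "ik = Yh - bW\<^sup>2 * kap"
  define P where "P = 12 * bT ^ 3 * bW\<^sup>2 * B + 4 * bT\<^sup>2 * ik\<^sup>2 - 2 * bT * bW * ik + 4 * bT\<^sup>2 * bW\<^sup>2 - bW\<^sup>2
     + 2 * bT * bW ^ 3 * kap"
  have P: "P = rho * (bW\<^sup>2 * Q)" unfolding P_def ik_def by (rule uniformized[OF B(1)])
  have ik_supp: "ik \<in> supp wside" unfolding ik_def by (intro supp_intros kap) simp_all
  have c_rho: "const0 rho \<noteq> 0" using rho(2) by simp
  have irho: "rho * inverse rho = 1" by (rule bps_inverse[OF c_rho])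
  have core_supp: "core \<in> supp vside" unfolding d(1) by (intro supp_intros d x) simp_all
  have Q_supp: "Q \<in> supp vside" unfolding Q_def by (intro supp_intros x ix core_supp) simp_all
  have P_supp: "P * inverse rho \<in> supp wside" unfolding P_def
    by (intro supp_intros B ik_supp kap supp_inverse c_rho) simp_all
  have "P * inverse rho = bW\<^sup>2 * Q" using P irho by algebra
  from sides_match[OF P_supp Q_supp this] obtain q0 q1 q2 where
    q: "Q = diag q0 + bV * diag q1 + bV\<^sup>2 * diag q2"
       "P * inverse rho = diag (fps_X\<^sup>2 * q2) + bW * diag (fps_X * q1) + bW\<^sup>2 * diag q0" .

  define c where "c = - half * (bT * diag \<alpha> + diag \<epsilon>)"
  define i1 where "i1 = inverse (1 + rho)"
  have i1_supp: "i1 \<in> supp wside" unfolding i1_def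
    by (intro supp_intros supp_inverse) (simp_all add: const0_1rho del: fps_add_nth)
  define g where "g = half * (diag \<alpha> * i1 + diag \<epsilon> * (half * bT * diag \<alpha> + bW * r)) - r - kap"
  have ik: "ik = 1 + bW * c + bW\<^sup>2 * g"
  proof -
    have "ik = rho + half * bW * (diag \<alpha> * bW * i1 - diag \<epsilon> * rho) - bW\<^sup>2 * kap"
      by (simp add: ik_def Yh_def i1_def)
    also have "\<dots> = 1 + bW * c + bW\<^sup>2 * g"
      unfolding r(1) g_def c_def by algebra
    finally show ?thesis .
  qed
  have g_supp: "g \<in> supp wside" unfolding g_def by (intro supp_intros r i1_supp kap) simp_all
  have c_diag: "c = diag (- fps_const (1/2) * (fps_X * \<alpha> + \<epsilon>))"
    by (simp add: c_def half_def bconst_def)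
  have c_supp: "c \<in> supp wside" unfolding c_diag by (rule diag_sides)
  define f1 where "f1 = 8 * bT\<^sup>2 * g + 4 * bT\<^sup>2 * (c + bW * g)\<^sup>2 + 12 * bT ^ 3 * B - 2 * bT * (c + bW * g)
    + 4 * bT\<^sup>2 - 1 + 2 * bT * bW * kap"
  define f2 where "f2 = rho * diag q0 - half * bT * diag \<alpha> * diag (fps_X * q1) - r * diag (fps_X\<^sup>2 * q2)
    - bW * r * diag (fps_X * q1)"
  have "P = 4 * bT\<^sup>2 + bW * (8 * bT\<^sup>2 * c - 2 * bT) + bW\<^sup>2 * f1"
    unfolding P_def ik f1_def by algebra
  moreover have "P = rho * (diag (fps_X\<^sup>2 * q2) + bW * diag (fps_X * q1) + bW\<^sup>2 * diag q0)"
    using q(2) irho by algebra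
  then have "P = diag (fps_X\<^sup>2 * q2) + bW * (diag (fps_X * q1) - half * bT * diag \<alpha> * diag (fps_X\<^sup>2 * q2))
      + bW\<^sup>2 * f2"
    unfolding f2_def using r(1) by algebra
  ultimately have "diag (4 * fps_X\<^sup>2) + bW * ((8 * bT\<^sup>2 * c - 2 * bT) + bW * f1) =
    diag (fps_X\<^sup>2 * q2) + bW * ((diag (fps_X * q1) - half * bT * diag \<alpha> * diag (fps_X\<^sup>2 * q2)) + bW * f2)"
    by (simp add: algebra_simps power2_eq_square)
  moreover have f1_supp: "f1 \<in> supp wside" unfolding f1_def
    by (intro supp_intros g_supp c_supp B kap) simp_all
  moreover have f2_supp: "f2 \<in> supp wside" unfolding f2_def
    by (intro supp_intros r diag_sides) simp_all
  moreover have "(8 * bT\<^sup>2 * c - 2 * bT) + bW * f1 \<in> supp wside"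
    by (intro supp_intros c_supp f1_supp) simp_all
  moreover have "(diag (fps_X * q1) - half * bT * diag \<alpha> * diag (fps_X\<^sup>2 * q2)) + bW * f2 \<in> supp wside"
    by (intro supp_intros f2_supp diag_sides) simp_all
  ultimately have q2: "4 * fps_X\<^sup>2 = fps_X\<^sup>2 * q2" and
    nxt: "(8 * bT\<^sup>2 * c - 2 * bT) + bW * f1 =
      (diag (fps_X * q1) - half * bT * diag \<alpha> * diag (fps_X\<^sup>2 * q2)) + bW * f2"
    using wside_decomp_unique by blast+
  have "8 * bT\<^sup>2 * c - 2 * bT = diag (8 * fps_X\<^sup>2 * (- fps_const (1/2) * (fps_X * \<alpha> + \<epsilon>)) - 2 * fps_X)"
    by (simp add: c_diag)
  moreover have "diag (fps_X * q1) - half * bT * diag \<alpha> * diag (fps_X\<^sup>2 * q2)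
     = diag (fps_X * q1 - fps_const (1/2) * fps_X * \<alpha> * (fps_X\<^sup>2 * q2))"
    by (simp add: half_def bconst_def)
  ultimately have "8 * fps_X\<^sup>2 * (- fps_const (1/2) * (fps_X * \<alpha> + \<epsilon>)) - 2 * fps_X =
      fps_X * q1 - fps_const (1/2) * fps_X * \<alpha> * (fps_X\<^sup>2 * q2)"
    using nxt f1_supp f2_supp wside_decomp_unique by metis
  moreover have half: "2 * fps_const (1/2 :: real) = 1"
    by (simp add: fps_numeral_fps_const)
  ultimately have "fps_X * q1 = fps_X * (2 - 4 * e - 2 * A)"
    using q2 A_eq e_eq by algebra
  then have q1_w: "q1 = 2 - 4 * e - 2 * A" by (simp only: mult_cancel_left fps_X_neq_zero simp_thms)

  define t where "t = 2 + 6 * bT\<^sup>2 * diag d0"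
  define f3 where "f3 = d + 2 * ix * core + 2 * (t + x * d)"
  have "(1 + x) * ix = 1 + 2 * x + 2 * x\<^sup>2 * ix" using ix(1) by algebra
  then have "(1 + x) * ix * core = 1 + x * (2 + t) + x\<^sup>2 * f3"
    unfolding f3_def using d(1) unfolding t_def[symmetric] by algebra
  then have "Q = (2 * bV - dE) * (1 + x * (2 + t) + x\<^sup>2 * f3)" unfolding Q_def by algebra
  then have Q2: "Q = - dE + bV * (2 - dE * diag l0 * (2 + t) + bV * (2 * lam * (2 + t) - dE * m * (2 + t)
      + (2 * bV - dE) * lam\<^sup>2 * f3))"
    unfolding x_def using l(1) by algebra
  have t_diag: "2 + t = diag (4 + 6 * fps_X\<^sup>2 * d0)" by (simp add: t_def)
  have t_supp: "2 + t \<in> supp vside" unfolding t_diag by (rule diag_sides)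
  have "t \<in> supp vside" unfolding t_def by (intro supp_intros) simp_all
  then have "f3 \<in> supp vside" unfolding f3_def by (intro supp_intros d ix core_supp x) simp_all
  then have f4: "2 * lam * (2 + t) - dE * m * (2 + t) + (2 * bV - dE) * lam\<^sup>2 * f3 \<in> supp vside" (is "?f4 \<in> _")
    by (intro supp_intros lam l t_supp) simp_all
  have lin: "diag (2 - e * l0 * (4 + 6 * fps_X\<^sup>2 * d0)) = 2 - dE * diag l0 * (2 + t)"
    by (simp add: t_diag)
  have neg: "diag (- e) = - dE" by simp
  have "diag q0 + bV * (diag q1 + bV * diag q2) =
    diag (- e) + bV * (diag (2 - e * l0 * (4 + 6 * fps_X\<^sup>2 * d0)) + bV * ?f4)"
    unfolding lin neg using Q2 q(1) by algebra
  moreover have "diag q1 + bV * diag q2 \<in> supp vside"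
    "diag (2 - e * l0 * (4 + 6 * fps_X\<^sup>2 * d0)) + bV * ?f4 \<in> supp vside"
    by (intro supp_intros f4 diag_sides; simp)+
  ultimately have "diag q1 + bV * diag q2 = diag (2 - e * l0 * (4 + 6 * fps_X\<^sup>2 * d0)) + bV * ?f4"
    using vside_decomp_unique by blast
  then have "q1 = 2 - e * l0 * (4 + 6 * fps_X\<^sup>2 * d0)"
    using vside_decomp_unique f4 diag_sides by blast
  then have "2 * (12 * fps_X ^ 4 * d0 + 8 * fps_X\<^sup>2) = 2 * (A * e * (2 * e + A))"
    using q1_w l(3) by algebra
  then show ?thesis unfolding d0_def by (simp only: mult_cancel_left) simp
qed

end

section \<open>The hypergeometric coefficients\<close>

text \<open>The Euler operator, which multiplies the \<open>n\<close>-th coefficient by \<open>n\<close> and so turns recurrences with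
  polynomial coefficients into differential equations.\<close>

definition theta_op :: "real fps \<Rightarrow> real fps" where
  "theta_op f = fps_X * fps_deriv f"

lemma theta_op_nth: "fps_nth (theta_op f) n = real n * fps_nth f n"
  by (simp add: theta_op_def)

lemma theta_op_simps:
  "theta_op (f + g) = theta_op f + theta_op g"
  "theta_op (f - g) = theta_op f - theta_op g"
  "theta_op (- f) = - theta_op f"
  "theta_op (f * g) = theta_op f * g + f * theta_op g"
  "theta_op (numeral k) = 0" "theta_op 1 = 0" "theta_op 0 = 0"
  by (simp_all add: theta_op_def algebra_simps)

lemma theta_op_power: "theta_op (f ^ Suc n) = of_nat (Suc n) * f ^ n * theta_op f"
  by (induction n) (simp_all add: theta_op_simps algebra_simps)

text \<open>The relations between \<open>A\<close>, \<open>e\<close> and \<open>t\<close> define a curve of genus 0, and \<open>Z\<close> is a rational coordinate on it.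
  In this part \<open>fps_X\<close> stands for \<open>t\<^sup>2\<close>.\<close>

locale Z_series =
  fixes Z :: "real fps"
  assumes Z0: "fps_nth Z 0 = 1"
    and Z_eq: "256 * fps_X * Z ^ 6 = (Z\<^sup>2 - 1) * (Z\<^sup>2 + 3) ^ 3"
begin

definition "z = inverse Z"
definition "w = Z\<^sup>2 - 3"
definition "kk = (Z\<^sup>2 - 1) * (Z\<^sup>2 + 3)"
definition "k = kk * inverse (2 * w\<^sup>2)"

lemma Zz: "Z * z = 1"
  unfolding z_def by (rule inverse_mult_eq_1') (simp add: Z0)

lemma w0: "fps_nth w 0 = -2" and w_nz: "w \<noteq> 0"
proof -
  show "fps_nth w 0 = -2" by (simp add: w_def Z0 power2_eq_square fps_numeral_nth)
  then show "w \<noteq> 0" by force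
qed

lemma k: "2 * w\<^sup>2 * k = kk"
proof -
  have "2 * w\<^sup>2 * inverse (2 * w\<^sup>2) = 1"
    by (rule inverse_mult_eq_1') (simp add: w0 power2_eq_square fps_numeral_nth)
  then show ?thesis unfolding k_def by algebra
qed

lemma theta_Z: "theta_op Z = Z * k"
proof -
  have p: "theta_op (Z ^ 2) = 2 * Z * theta_op Z" "theta_op (Z ^ 6) = 6 * Z ^ 5 * theta_op Z"
    "theta_op ((Z\<^sup>2 + 3) ^ 3) = 3 * (Z\<^sup>2 + 3)\<^sup>2 * (2 * Z * theta_op Z)"
    using theta_op_power[of Z 1] theta_op_power[of Z 5] theta_op_power[of "Z\<^sup>2 + 3" 2]
    by (simp_all add: numeral_eq_Suc theta_op_simps)
  have X: "theta_op fps_X = fps_X" by (simp add: theta_op_def)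
  have "theta_op (256 * fps_X * Z ^ 6) = theta_op ((Z\<^sup>2 - 1) * (Z\<^sup>2 + 3) ^ 3)"
    by (simp only: Z_eq)
  then have e: "256 * fps_X * Z ^ 6 + 256 * fps_X * (6 * Z ^ 5 * theta_op Z) =
     2 * Z * theta_op Z * (Z\<^sup>2 + 3) ^ 3 + (Z\<^sup>2 - 1) * (3 * (Z\<^sup>2 + 3)\<^sup>2 * (2 * Z * theta_op Z))"
    by (simp only: theta_op_simps p X mult_zero_left mult_zero_right add_0 add_0_right diff_0_right)
  have "(Z\<^sup>2 + 3)\<^sup>2 * (2 * w\<^sup>2 * theta_op Z - Z * kk) =
     Z * (2 * Z * theta_op Z * (Z\<^sup>2 + 3) ^ 3 + (Z\<^sup>2 - 1) * (3 * (Z\<^sup>2 + 3)\<^sup>2 * (2 * Z * theta_op Z)))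
     - (Z\<^sup>2 - 1) * (Z\<^sup>2 + 3) ^ 3 * (Z + 6 * theta_op Z)"
    unfolding w_def kk_def by algebra
  also have "\<dots> = 0" unfolding e[symmetric] Z_eq[symmetric] by algebra
  finally have "(Z\<^sup>2 + 3)\<^sup>2 * (2 * w\<^sup>2 * theta_op Z - Z * kk) = 0" .
  moreover have "fps_nth ((Z\<^sup>2 + 3)\<^sup>2) 0 \<noteq> 0"
    by (simp add: Z0 power2_eq_square fps_numeral_nth)
  then have "(Z\<^sup>2 + 3)\<^sup>2 \<noteq> 0" by force
  ultimately have "2 * w\<^sup>2 * theta_op Z = Z * kk" by simp
  then have "2 * w\<^sup>2 * (theta_op Z - Z * k) = 0" unfolding k[symmetric] by (simp add: algebra_simps)
  then have "w\<^sup>2 * (theta_op Z - Z * k) = 0" by (simp only: mult.assoc mult_eq_0_iff) simp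
  then show ?thesis using w_nz by simp
qed

lemma theta_z: "theta_op z = - (z * k)"
proof -
  have "theta_op (Z * z) = 0" by (simp add: Zz theta_op_simps)
  then have "z * (Z * k * z + Z * theta_op z) = 0" by (simp add: theta_op_simps theta_Z)
  then show ?thesis using Zz by algebra
qed

lemma theta_powers: "theta_op (Z ^ n) = of_nat n * (Z ^ n * k)" "theta_op (z ^ n) = - (of_nat n * (z ^ n * k))"
  by (induction n) (simp_all add: theta_op_simps theta_Z theta_z algebra_simps)

lemma theta_k: "w ^ 3 * theta_op k = - 8 * Z ^ 4 * k"
proof -
  have "theta_op (2 * w\<^sup>2 * k) = theta_op kk" by (simp only: k)
  moreover have "theta_op (Z\<^sup>2) = 2 * (Z\<^sup>2 * k)" by (simp add: theta_powers)
  moreover have "theta_op (w\<^sup>2) = 2 * w * theta_op (Z\<^sup>2)"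
    using theta_op_power[of w 1] by (simp add: numeral_eq_Suc w_def theta_op_simps)
  ultimately have "4 * w * (2 * (Z\<^sup>2 * k)) * k + 2 * w\<^sup>2 * theta_op k
     = 2 * (Z\<^sup>2 * k) * (Z\<^sup>2 + 3) + (Z\<^sup>2 - 1) * (2 * (Z\<^sup>2 * k))"
    by (simp only: kk_def theta_op_simps mult_zero_left add_0 diff_0_right add_0_right) algebra
  then have "2 * w\<^sup>2 * theta_op k = k * (4 * Z\<^sup>2 * (Z\<^sup>2 + 1) - 8 * w * Z\<^sup>2 * k)" by algebra
  then have "2 * (w ^ 3 * theta_op k) = w * (k * (4 * Z\<^sup>2 * (Z\<^sup>2 + 1))) - 4 * Z\<^sup>2 * k * (2 * w\<^sup>2 * k)"
    by algebra
  also have "\<dots> = 2 * (- 8 * Z ^ 4 * k)"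
    unfolding k unfolding kk_def w_def by algebra
  finally have "2 * (w ^ 3 * theta_op k) = 2 * (- 8 * Z ^ 4 * k)" .
  then show ?thesis by (simp only: mult_cancel_left) simp
qed

lemma X_eq: "256 * fps_X * Z ^ 6 = kk * (Z\<^sup>2 + 3)\<^sup>2"
  unfolding kk_def Z_eq by algebra

text \<open>If a solution of one of the two hypergeometric equations is rational in \<open>Z\<close>, then its poles can only lie
  over \<open>t = \<infinity>\<close>, that is at \<open>Z = 0\<close> and \<open>Z = \<infinity>\<close>; the local exponents bound the pole orders by 9 and 3.
  The coefficients below solve the resulting linear system; \<open>u1/5120\<close> and \<open>u2/35840\<close> are the generating
  functions of the two hypergeometric terms, multiplied by \<open>t\<^sup>4\<close>.\<close>

definition "u1 = 81 * z ^ 9 - 405 * z ^ 6 + 405 * z ^ 5 - 216 * z ^ 3 + 270 * z ^ 2 - 261 * z ^ 1 + 184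
   - 72 * Z ^ 1 + 15 * Z ^ 2 - Z ^ 3"
definition "u2 = 810 * z ^ 9 - 2916 * z ^ 7 + 2835 * z ^ 6 - 810 * z ^ 5 + 648 * z ^ 3 - 1890 * z ^ 2
   + 2358 * z ^ 1 - 1480 + 540 * Z ^ 1 - 105 * Z ^ 2 + 10 * Z ^ 3"

text \<open>The Euler derivative of \<open>Z\<close> is \<open>Z k\<close> with a denominator \<open>2 w\<^sup>2\<close>; multiplication by \<open>4 w\<^sup>5\<close> clears the
  denominators of the first two derivatives of a Laurent polynomial in \<open>Z\<close>.\<close>

lemma theta_derivatives:
  assumes 1: "theta_op u = k * v" and 2: "theta_op v = k * v'"
  shows "4 * w ^ 5 * theta_op u = 2 * w ^ 3 * kk * v"
    "4 * w ^ 5 * theta_op (theta_op u) = - 16 * Z ^ 4 * kk * v + w * kk\<^sup>2 * v'"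
proof -
  show "4 * w ^ 5 * theta_op u = 2 * w ^ 3 * kk * v"
    unfolding 1 k[symmetric] by algebra
  have "theta_op (theta_op u) = theta_op k * v + k\<^sup>2 * v'"
    by (simp add: 1 2 theta_op_simps power2_eq_square algebra_simps)
  then have "4 * w ^ 5 * theta_op (theta_op u) = 4 * w\<^sup>2 * (w ^ 3 * theta_op k) * v + w * (2 * w\<^sup>2 * k)\<^sup>2 * v'"
    by algebra
  then show "4 * w ^ 5 * theta_op (theta_op u) = - 16 * Z ^ 4 * kk * v + w * kk\<^sup>2 * v'"
    unfolding theta_k unfolding k[symmetric] by algebra
qed

text \<open>The images of \<open>u1\<close> and \<open>u2\<close> under the first and second power of the operator \<open>Z d/dZ\<close>.\<close>

definition "v1 = - 729 * z ^ 9 + 2430 * z ^ 6 - 2025 * z ^ 5 + 648 * z ^ 3 - 540 * z ^ 2 + 261 * z ^ 1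
   - 72 * Z ^ 1 + 30 * Z ^ 2 - 3 * Z ^ 3"
definition "v1' = 6561 * z ^ 9 - 14580 * z ^ 6 + 10125 * z ^ 5 - 1944 * z ^ 3 + 1080 * z ^ 2 - 261 * z ^ 1
   - 72 * Z ^ 1 + 60 * Z ^ 2 - 9 * Z ^ 3"
definition "v2 = - 7290 * z ^ 9 + 20412 * z ^ 7 - 17010 * z ^ 6 + 4050 * z ^ 5 - 1944 * z ^ 3 + 3780 * z ^ 2
   - 2358 * z ^ 1 + 540 * Z ^ 1 - 210 * Z ^ 2 + 30 * Z ^ 3"
definition "v2' = 65610 * z ^ 9 - 142884 * z ^ 7 + 102060 * z ^ 6 - 20250 * z ^ 5 + 5832 * z ^ 3 - 7560 * z ^ 2
   + 2358 * z ^ 1 + 540 * Z ^ 1 - 420 * Z ^ 2 + 90 * Z ^ 3"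

lemma theta_u: "theta_op u1 = k * v1" "theta_op v1 = k * v1'" "theta_op u2 = k * v2" "theta_op v2 = k * v2'"
  by (simp_all only: u1_def u2_def v1_def v2_def v1'_def v2'_def theta_op_simps theta_powers of_nat_numeral of_nat_1
     mult_zero_left add_0 mult_1 diff_0_right add_0_right)
   (simp_all add: algebra_simps)

lemma clear_z:
  "Z ^ 9 * u1 = 81 - 405 * Z ^ 3 + 405 * Z ^ 4 - 216 * Z ^ 6 + 270 * Z ^ 7 - 261 * Z ^ 8 + 184 * Z ^ 9
   - 72 * Z ^ 10 + 15 * Z ^ 11 - Z ^ 12" (is ?u1)
  "Z ^ 9 * u2 = 810 - 2916 * Z ^ 2 + 2835 * Z ^ 3 - 810 * Z ^ 4 + 648 * Z ^ 6 - 1890 * Z ^ 7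
   + 2358 * Z ^ 8 - 1480 * Z ^ 9 + 540 * Z ^ 10 - 105 * Z ^ 11 + 10 * Z ^ 12" (is ?u2)
  "Z ^ 9 * v1 = - 729 + 2430 * Z ^ 3 - 2025 * Z ^ 4 + 648 * Z ^ 6 - 540 * Z ^ 7 + 261 * Z ^ 8
   - 72 * Z ^ 10 + 30 * Z ^ 11 - 3 * Z ^ 12" (is ?v1)
  "Z ^ 9 * v1' = 6561 - 14580 * Z ^ 3 + 10125 * Z ^ 4 - 1944 * Z ^ 6 + 1080 * Z ^ 7 - 261 * Z ^ 8
   - 72 * Z ^ 10 + 60 * Z ^ 11 - 9 * Z ^ 12" (is ?v1')
  "Z ^ 9 * v2 = - 7290 + 20412 * Z ^ 2 - 17010 * Z ^ 3 + 4050 * Z ^ 4 - 1944 * Z ^ 6 + 3780 * Z ^ 7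
   - 2358 * Z ^ 8 + 540 * Z ^ 10 - 210 * Z ^ 11 + 30 * Z ^ 12" (is ?v2)
  "Z ^ 9 * v2' = 65610 - 142884 * Z ^ 2 + 102060 * Z ^ 3 - 20250 * Z ^ 4 + 5832 * Z ^ 6 - 7560 * Z ^ 7
   + 2358 * Z ^ 8 + 540 * Z ^ 10 - 420 * Z ^ 11 + 90 * Z ^ 12" (is ?v2')
proof -
  have p: "Z ^ 9 * z ^ n = Z ^ (9 - n)" if "n \<le> 9" for n
  proof -
    have "Z ^ 9 = Z ^ (9 - n) * Z ^ n" using that by (simp flip: power_add)
    then show ?thesis using Zz by (simp add: mult.assoc flip: power_mult_distrib)
  qed
  have q: "Z ^ 9 * Z ^ n = Z ^ (9 + n)" for n by (simp add: power_add)
  have s: "Z ^ 9 * (numeral m * a) = numeral m * (Z ^ 9 * a)" "Z ^ 9 * - a = - (Z ^ 9 * a)"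
    "Z ^ 9 * numeral m = numeral m * Z ^ 9"
    "Z ^ 9 * (- numeral m * a) = - (numeral m * (Z ^ 9 * a))" for m and a :: "real fps"
    by (simp_all add: mult_ac)
  have ps: "Z ^ 9 * z ^ 9 = 1" "Z ^ 9 * z ^ 7 = Z ^ 2" "Z ^ 9 * z ^ 6 = Z ^ 3" "Z ^ 9 * z ^ 5 = Z ^ 4"
    "Z ^ 9 * z ^ 3 = Z ^ 6" "Z ^ 9 * z ^ 2 = Z ^ 7" "Z ^ 9 * z ^ 1 = Z ^ 8"
    "Z ^ 9 * Z ^ 1 = Z ^ 10" "Z ^ 9 * Z ^ 2 = Z ^ 11" "Z ^ 9 * Z ^ 3 = Z ^ 12"
    using p[of 9] p[of 7] p[of 6] p[of 5] p[of 3] p[of 2] p[of 1] q[of 1] q[of 2] q[of 3]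
    by (simp_all del: power_one_right)
  show ?u1 ?u2 ?v1 ?v1' ?v2 ?v2'
    unfolding u1_def u2_def v1_def v1'_def v2_def v2'_def distrib_left right_diff_distrib s ps
    by simp_all
qed

lemma nonzero: "1024 * w ^ 5 * Z ^ 15 \<noteq> 0" "4 * w ^ 5 * Z ^ 9 \<noteq> 0"
proof -
  have "Z \<noteq> 0" using Zz by auto
  then show "1024 * w ^ 5 * Z ^ 15 \<noteq> 0" "4 * w ^ 5 * Z ^ 9 \<noteq> 0" using w_nz by auto
qed

lemmas cleared1 = theta_derivatives[OF theta_u(1,2)]
lemmas cleared2 = theta_derivatives[OF theta_u(3,4)]

lemma ode1:
  "12 * theta_op (theta_op u1) - 8 * theta_op u1
     - fps_X * (192 * theta_op (theta_op u1) - 448 * theta_op u1 + 240 * u1) = 61440 * fps_X\<^sup>2"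
  (is "?L = _")
proof -
  define q where "q = kk * (Z\<^sup>2 + 3)\<^sup>2"
  define U V V' where "U = Z ^ 9 * u1" and "V = Z ^ 9 * v1" and "V' = Z ^ 9 * v1'"
  define T1 T2 where "T1 = 2 * w ^ 3 * kk * V" and "T2 = - 16 * Z ^ 4 * kk * V + w * kk\<^sup>2 * V'"
  have T: "Z ^ 9 * (4 * w ^ 5 * theta_op u1) = T1" "Z ^ 9 * (4 * w ^ 5 * theta_op (theta_op u1)) = T2"
    unfolding cleared1 T1_def T2_def V_def V'_def by algebra+
  have X: "256 * fps_X * Z ^ 6 = q" using X_eq by (simp add: q_def)
  have "1024 * w ^ 5 * Z ^ 15 * (?L - 61440 * fps_X\<^sup>2) =
      256 * Z ^ 6 * (12 * (Z ^ 9 * (4 * w ^ 5 * theta_op (theta_op u1))) - 8 * (Z ^ 9 * (4 * w ^ 5 * theta_op u1)))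
      - (256 * fps_X * Z ^ 6) * (192 * (Z ^ 9 * (4 * w ^ 5 * theta_op (theta_op u1)))
          - 448 * (Z ^ 9 * (4 * w ^ 5 * theta_op u1)) + 960 * w ^ 5 * U)
      - 960 * w ^ 5 * Z ^ 3 * (256 * fps_X * Z ^ 6)\<^sup>2"
    unfolding U_def by algebra
  also have "\<dots> = 256 * Z ^ 6 * (12 * T2 - 8 * T1) - q * (192 * T2 - 448 * T1 + 960 * w ^ 5 * U)
      - 960 * w ^ 5 * Z ^ 3 * q\<^sup>2"
    unfolding T X ..
  also have "\<dots> = 0"
    unfolding T1_def T2_def U_def V_def V'_def clear_z q_def kk_def w_def by algebra
  finally show ?thesis using nonzero(1) by (simp only: mult_eq_0_iff) simp
qed

lemma ode2:
  "12 * theta_op (theta_op u2) - 4 * theta_op u2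
     - fps_X * (192 * theta_op (theta_op u2) - 512 * theta_op u2 + 336 * u2) = 430080 * fps_X\<^sup>2"
  (is "?L = _")
proof -
  define q where "q = kk * (Z\<^sup>2 + 3)\<^sup>2"
  define U V V' where "U = Z ^ 9 * u2" and "V = Z ^ 9 * v2" and "V' = Z ^ 9 * v2'"
  define T1 T2 where "T1 = 2 * w ^ 3 * kk * V" and "T2 = - 16 * Z ^ 4 * kk * V + w * kk\<^sup>2 * V'"
  have T: "Z ^ 9 * (4 * w ^ 5 * theta_op u2) = T1" "Z ^ 9 * (4 * w ^ 5 * theta_op (theta_op u2)) = T2"
    unfolding cleared2 T1_def T2_def V_def V'_def by algebra+
  have X: "256 * fps_X * Z ^ 6 = q" using X_eq by (simp add: q_def)
  have "1024 * w ^ 5 * Z ^ 15 * (?L - 430080 * fps_X\<^sup>2) =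
      256 * Z ^ 6 * (12 * (Z ^ 9 * (4 * w ^ 5 * theta_op (theta_op u2))) - 4 * (Z ^ 9 * (4 * w ^ 5 * theta_op u2)))
      - (256 * fps_X * Z ^ 6) * (192 * (Z ^ 9 * (4 * w ^ 5 * theta_op (theta_op u2)))
          - 512 * (Z ^ 9 * (4 * w ^ 5 * theta_op u2)) + 1344 * w ^ 5 * U)
      - 6720 * w ^ 5 * Z ^ 3 * (256 * fps_X * Z ^ 6)\<^sup>2"
    unfolding U_def by algebra
  also have "\<dots> = 256 * Z ^ 6 * (12 * T2 - 4 * T1) - q * (192 * T2 - 512 * T1 + 1344 * w ^ 5 * U)
      - 6720 * w ^ 5 * Z ^ 3 * q\<^sup>2"
    unfolding T X ..
  also have "\<dots> = 0"
    unfolding T1_def T2_def U_def V_def V'_def clear_z q_def kk_def w_def by algebra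
  finally show ?thesis using nonzero(1) by (simp only: mult_eq_0_iff) simp
qed

text \<open>For a series multiplied by \<open>t\<^sup>4\<close>, the factor \<open>24 n\<^sup>2 + 60 n + 29\<close> is the action of
  \<open>24 \<theta>\<^sup>2 - 36 \<theta> + 5\<close>, and \<open>12 n\<^sup>2 + 30 n + 5\<close> is that of \<open>12 \<theta>\<^sup>2 - 18 \<theta> - 7\<close>.\<close>

lemma combination:
  "11340 * ((Z\<^sup>2 - 1) * (Z\<^sup>2 + 1)\<^sup>2 * (Z ^ 4 + 4 * Z\<^sup>2 - 1) * z ^ 9 - 64 * fps_X) =
    14 * (24 * theta_op (theta_op u1) - 36 * theta_op u1 + 5 * u1)
      - (12 * theta_op (theta_op u2) - 18 * theta_op u2 - 7 * u2)"
  (is "?L = ?R")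
proof -
  define q where "q = kk * (Z\<^sup>2 + 3)\<^sup>2"
  define U V V' where "U = Z ^ 9 * u1" and "V = Z ^ 9 * v1" and "V' = Z ^ 9 * v1'"
  define U2 V2 V2' where "U2 = Z ^ 9 * u2" and "V2 = Z ^ 9 * v2" and "V2' = Z ^ 9 * v2'"
  define T1 T2 where "T1 = 2 * w ^ 3 * kk * V" and "T2 = - 16 * Z ^ 4 * kk * V + w * kk\<^sup>2 * V'"
  define S1 S2 where "S1 = 2 * w ^ 3 * kk * V2" and "S2 = - 16 * Z ^ 4 * kk * V2 + w * kk\<^sup>2 * V2'"
  have T: "Z ^ 9 * (4 * w ^ 5 * theta_op u1) = T1" "Z ^ 9 * (4 * w ^ 5 * theta_op (theta_op u1)) = T2"
    unfolding cleared1 T1_def T2_def V_def V'_def by algebra+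
  have S: "Z ^ 9 * (4 * w ^ 5 * theta_op u2) = S1" "Z ^ 9 * (4 * w ^ 5 * theta_op (theta_op u2)) = S2"
    unfolding cleared2 S1_def S2_def V2_def V2'_def by algebra+
  have X: "256 * fps_X * Z ^ 6 = q" using X_eq by (simp add: q_def)
  have z9: "Z ^ 9 * z ^ 9 = 1" using Zz by (simp flip: power_mult_distrib)
  have "4 * w ^ 5 * Z ^ 9 * ?L = 11340 * (4 * w ^ 5 * ((Z\<^sup>2 - 1) * (Z\<^sup>2 + 1)\<^sup>2 * (Z ^ 4 + 4 * Z\<^sup>2 - 1)) * (Z ^ 9 * z ^ 9)
     - w ^ 5 * Z ^ 3 * (256 * fps_X * Z ^ 6))"
    by algebra
  also have "\<dots> = 11340 * (4 * w ^ 5 * ((Z\<^sup>2 - 1) * (Z\<^sup>2 + 1)\<^sup>2 * (Z ^ 4 + 4 * Z\<^sup>2 - 1)) - w ^ 5 * Z ^ 3 * q)"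
    unfolding X z9 by simp
  also have "\<dots> = 14 * (24 * T2 - 36 * T1 + 20 * w ^ 5 * U) - (12 * S2 - 18 * S1 - 28 * w ^ 5 * U2)"
    unfolding T1_def T2_def U_def V_def V'_def S1_def S2_def U2_def V2_def V2'_def clear_z q_def kk_def w_def
    by algebra
  also have "\<dots> = 4 * w ^ 5 * Z ^ 9 * ?R"
    unfolding T[symmetric] S[symmetric] U_def U2_def by algebra
  finally show ?thesis using nonzero(2) by (simp only: mult_cancel_left) simp
qed

lemma u_zero: "fps_nth u1 0 = 0" "fps_nth u2 0 = 0"
proof -
  have "fps_nth z 0 = 1" by (simp add: z_def Z0)
  then show "fps_nth u1 0 = 0" "fps_nth u2 0 = 0"
    by (simp_all add: u1_def u2_def fps_numeral_nth fps_power_zeroth Z0)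
qed

lemma X_mult_nth: "fps_nth (fps_X * f) n = (if n = 0 then 0 else fps_nth f (n - 1))" for f :: "real fps"
  by simp

lemma num_mult_nth: "fps_nth (numeral m * f) n = numeral m * fps_nth f n" for f :: "real fps"
  by (simp add: numeral_fps_const)

lemma rec1: "(12 * real n ^ 2 - 8 * real n) * fps_nth u1 n =
    (if n = 0 then 0 else (192 * real (n - 1) ^ 2 - 448 * real (n - 1) + 240) * fps_nth u1 (n - 1))
    + (if n = 2 then 61440 else 0)"
proof -
  from arg_cong[OF ode1, of "\<lambda>f. fps_nth f n"]
  have "12 * (n * (n * fps_nth u1 n)) - 8 * (n * fps_nth u1 n) -
      (if n = 0 then 0 else 192 * (real (n - 1) * (real (n - 1) * fps_nth u1 (n - 1)))
         - 448 * (real (n - 1) * fps_nth u1 (n - 1)) + 240 * fps_nth u1 (n - 1))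
      = 61440 * (if n = 2 then 1 else 0)"
    by (simp only: fps_sub_nth fps_add_nth num_mult_nth X_mult_nth theta_op_nth fps_X_power_nth)
  then show ?thesis
    by (cases "n = 0"; cases "n = 2") (simp_all add: power2_eq_square algebra_simps)
qed

lemma rec2: "(12 * real n ^ 2 - 4 * real n) * fps_nth u2 n =
    (if n = 0 then 0 else (192 * real (n - 1) ^ 2 - 512 * real (n - 1) + 336) * fps_nth u2 (n - 1))
    + (if n = 2 then 430080 else 0)"
proof -
  from arg_cong[OF ode2, of "\<lambda>f. fps_nth f n"]
  have "12 * (n * (n * fps_nth u2 n)) - 4 * (n * fps_nth u2 n) -
      (if n = 0 then 0 else 192 * (real (n - 1) * (real (n - 1) * fps_nth u2 (n - 1)))
         - 512 * (real (n - 1) * fps_nth u2 (n - 1)) + 336 * fps_nth u2 (n - 1))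
      = 430080 * (if n = 2 then 1 else 0)"
    by (simp only: fps_sub_nth fps_add_nth num_mult_nth X_mult_nth theta_op_nth fps_X_power_nth)
  then show ?thesis
    by (cases "n = 0"; cases "n = 2") (simp_all add: power2_eq_square algebra_simps)
qed

lemma u_one: "fps_nth u1 1 = 0" "fps_nth u2 1 = 0"
  using rec1[of 1] rec2[of 1] u_zero by simp_all

lemma solve_linear: "d \<noteq> 0 \<Longrightarrow> d * f = c * g \<Longrightarrow> f = c / d * g" for c d f g :: real
  by (simp add: field_simps)

lemma hypergeometric_step:
  "16 * p * q / (r * s) * (K * (16 ^ n * (a * b / (c * d)))) =
     K * (16 ^ Suc n * (a * p * (b * q) / (c * r * (d * s))))" for p q r s K a b c d :: real
  by (simp add: times_divide_times_eq mult_ac)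

lemma u1_nth: "fps_nth u1 (n + 2) = 5120 * (16 ^ n * (pochhammer (1/2) n * pochhammer (7/6) n
    / (pochhammer 2 (n + 1) * pochhammer (4/3) (n + 1))))"
proof (induction n)
  case 0
  show ?case using rec1[of 2] u_one by (simp add: numeral_2_eq_2)
next
  case (Suc n)
  have "(n + 3) * (n + 7/3) * fps_nth u1 (n + 3) = 16 * (n + 1/2) * (n + 7/6) * fps_nth u1 (n + 2)"
    using rec1[of "n + 3"] by (simp add: power2_eq_square field_simps)
  then have "fps_nth u1 (n + 3) = 16 * (n + 1/2) * (n + 7/6) / ((n + 3) * (n + 7/3)) * fps_nth u1 (n + 2)"
    by (rule solve_linear[rotated]) (auto simp: add_nonneg_eq_0_iff add_eq_0_iff)
  moreover have "pochhammer (2::real) (Suc n + 1) = pochhammer 2 (n + 1) * real (n + 3)"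
    "pochhammer (4/3::real) (Suc n + 1) = pochhammer (4/3) (n + 1) * (n + 7/3)"
    by (simp_all add: pochhammer_Suc field_simps)
  moreover have "pochhammer (1/2::real) (Suc n) = pochhammer (1/2) n * (n + 1/2)"
    "pochhammer (7/6::real) (Suc n) = pochhammer (7/6) n * (n + 7/6)"
    by (simp_all add: pochhammer_Suc field_simps)
  moreover have "Suc n + 2 = n + 3" by simp
  ultimately show ?case unfolding Suc by (simp only: hypergeometric_step)
qed

lemma u2_nth: "fps_nth u2 (n + 2) = 35840 * (16 ^ n * (pochhammer (1/2) n * pochhammer (5/6) n
    / (pochhammer 2 (n + 1) * pochhammer (5/3) (n + 1))))"
proof (induction n)
  case 0
  show ?case using rec2[of 2] u_one by (simp add: numeral_2_eq_2)
next
  case (Suc n)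
  have "(n + 3) * (n + 8/3) * fps_nth u2 (n + 3) = 16 * (n + 1/2) * (n + 5/6) * fps_nth u2 (n + 2)"
    using rec2[of "n + 3"] by (simp add: power2_eq_square field_simps)
  then have "fps_nth u2 (n + 3) = 16 * (n + 1/2) * (n + 5/6) / ((n + 3) * (n + 8/3)) * fps_nth u2 (n + 2)"
    by (rule solve_linear[rotated]) (auto simp: add_nonneg_eq_0_iff add_eq_0_iff)
  moreover have "pochhammer (2::real) (Suc n + 1) = pochhammer 2 (n + 1) * real (n + 3)"
    "pochhammer (5/3::real) (Suc n + 1) = pochhammer (5/3) (n + 1) * (n + 8/3)"
    by (simp_all add: pochhammer_Suc field_simps)
  moreover have "pochhammer (1/2::real) (Suc n) = pochhammer (1/2) n * (n + 1/2)"
    "pochhammer (5/6::real) (Suc n) = pochhammer (5/6) n * (n + 5/6)"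
    by (simp_all add: pochhammer_Suc field_simps)
  moreover have "Suc n + 2 = n + 3" by simp
  ultimately show ?case unfolding Suc by (simp only: hypergeometric_step)
qed

lemma algebraic_series:
  "(Z\<^sup>2 - 1) * (Z\<^sup>2 + 1)\<^sup>2 * (Z ^ 4 + 4 * Z\<^sup>2 - 1) * z ^ 9 = 64 * fps_X + 96 * fps_X\<^sup>2 *
    Abs_fps (\<lambda>n. 4 * 16 ^ n / 243 *
      (4 * (24 * real n ^ 2 + 60 * real n + 29) *
         (pochhammer (1/2) n * pochhammer (7/6) n / (pochhammer 2 (n + 1) * pochhammer (4/3) (n + 1)))
       - 2 * (12 * real n ^ 2 + 30 * real n + 5) *
         (pochhammer (1/2) n * pochhammer (5/6) n / (pochhammer 2 (n + 1) * pochhammer (5/3) (n + 1)))))"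
  (is "?L = 64 * fps_X + 96 * fps_X\<^sup>2 * ?F")
proof -
  have "11340 * (?L - 64 * fps_X) = 11340 * (96 * fps_X\<^sup>2 * ?F)"
    unfolding combination
  proof (rule fps_ext)
    fix n
    let ?G = "14 * (24 * theta_op (theta_op u1) - 36 * theta_op u1 + 5 * u1)
      - (12 * theta_op (theta_op u2) - 18 * theta_op u2 - 7 * u2)"
    have G: "fps_nth ?G n = 14 * (24 * real n ^ 2 - 36 * real n + 5) * fps_nth u1 n
      - (12 * real n ^ 2 - 18 * real n - 7) * fps_nth u2 n"
      by (simp only: fps_sub_nth fps_add_nth num_mult_nth theta_op_nth) (simp add: power2_eq_square algebra_simps)
    have R: "fps_nth (11340 * (96 * fps_X\<^sup>2 * ?F)) n = 1088640 * fps_nth (fps_X\<^sup>2 * ?F) n"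
      by (simp add: num_mult_nth mult.assoc)
    show "fps_nth ?G n = fps_nth (11340 * (96 * fps_X\<^sup>2 * ?F)) n"
    proof (cases "n < 2")
      case True
      then have "n = 0 \<or> n = 1" by auto
      then show ?thesis unfolding G R using u_zero u_one by (auto simp: fps_X_power_mult_nth)
    next
      case False
      then obtain m where m: "n = m + 2" by (metis add.commute le_Suc_ex not_less)
      have *: "14 * (24 * real (m + 2) ^ 2 - 36 * real (m + 2) + 5) * (5120 * (c * a))
          - (12 * real (m + 2) ^ 2 - 18 * real (m + 2) - 7) * (35840 * (c * b)) =
        1088640 * (4 * c / 243 * (4 * (24 * real m ^ 2 + 60 * real m + 29) * a
          - 2 * (12 * real m ^ 2 + 30 * real m + 5) * b))" for a b c :: real
        by (simp add: power2_eq_square algebra_simps)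
      have F: "fps_nth (fps_X\<^sup>2 * f) (m + 2) = fps_nth f m" for f :: "real fps"
        by (simp add: fps_X_power_mult_nth)
      show ?thesis unfolding G R unfolding m u1_nth u2_nth F fps_nth_Abs_fps * ..
    qed
  qed
  then have "?L - 64 * fps_X = 96 * fps_X\<^sup>2 * ?F" by (simp only: mult_cancel_left) simp
  then show ?thesis by (simp add: algebra_simps)
qed

end

text \<open>The square \<open>Z\<^sup>2 = 1 + u\<close> satisfies \<open>u (u + 4)\<^sup>3 = 256 t\<^sup>2 (1 + u)\<^sup>3\<close>, which is solved for \<open>u\<close> by a
  compositional inverse.\<close>

lemma Z_exists: "\<exists>Z. Z_series Z"
proof -
  define \<phi> :: "real fps" where "\<phi> = fps_X * (fps_X + 4) ^ 3 * inverse (256 * (1 + fps_X) ^ 3)"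
  have inv: "256 * (1 + fps_X) ^ 3 * inverse (256 * (1 + fps_X) ^ 3 :: real fps) = 1"
    by (rule inverse_mult_eq_1') (simp add: fps_numeral_nth fps_power_zeroth)
  have \<phi>: "\<phi> * (256 * (1 + fps_X) ^ 3) = fps_X * (fps_X + 4) ^ 3"
    using inv unfolding \<phi>_def by algebra
  have \<phi>0: "fps_nth \<phi> 0 = 0" by (simp add: \<phi>_def)
  have "fps_nth \<phi> 1 = fps_nth ((fps_X + 4) ^ 3 * inverse (256 * (1 + fps_X) ^ 3) :: real fps) 0"
    by (simp add: \<phi>_def mult.assoc)
  also have "\<dots> \<noteq> 0"
    by (simp add: fps_numeral_nth fps_power_zeroth)
  finally have \<phi>1: "fps_nth \<phi> 1 \<noteq> 0" .
  define \<iota> where "\<iota> = fps_inv \<phi>"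
  have \<iota>0: "fps_nth \<iota> 0 = 0" by (simp add: \<iota>_def fps_inv_def)
  have c: "\<phi> oo \<iota> = fps_X" unfolding \<iota>_def by (rule fps_inv_right[OF \<phi>0 \<phi>1])
  have num: "numeral m oo \<iota> = numeral m" for m by (simp add: numeral_fps_const)
  have "(\<phi> * (256 * (1 + fps_X) ^ 3)) oo \<iota> = (fps_X * (fps_X + 4) ^ 3) oo \<iota>"
    by (simp only: \<phi>)
  then have i: "fps_X * (256 * (1 + \<iota>) ^ 3) = \<iota> * (\<iota> + 4) ^ 3"
    by (simp only: fps_compose_mult_distrib[OF \<iota>0] fps_compose_power[OF \<iota>0, symmetric] fps_compose_add_distrib
        num c fps_compose_1 fps_X_fps_compose_startby0[OF \<iota>0])
  have "1 * 1 = fps_nth (1 + \<iota>) 0" "2 * 1 * (1/2 :: real) = 1" by (simp_all add: \<iota>0)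
  from fps_sqrt_exists[OF this] obtain Z where Z: "Z * Z = 1 + \<iota>" "fps_nth Z 0 = 1" by blast
  have "256 * fps_X * Z ^ 6 = fps_X * (256 * (Z * Z) ^ 3)" by algebra
  also have "\<dots> = (Z * Z - 1) * (Z * Z - 1 + 4) ^ 3" using i unfolding Z by simp
  also have "\<dots> = (Z\<^sup>2 - 1) * (Z\<^sup>2 + 3) ^ 3" by algebra
  finally have "Z_series Z" using Z(2) by unfold_locales
  then show ?thesis ..
qed

section \<open>The excursion numbers\<close>

context Z_series
begin

text \<open>The parameters \<open>A\<close> and \<open>e\<close> of the kernel curve as series in \<open>t\<^sup>2\<close>.\<close>

definition "A0 = (Z\<^sup>2 - 1) * z ^ 3"
definition "e0 = fps_const (1/4) * ((Z\<^sup>2 + 1)\<^sup>2 * z ^ 3)"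

lemma e0: "4 * e0 = (Z\<^sup>2 + 1)\<^sup>2 * z ^ 3"
proof -
  have "4 * fps_const (1/4 :: real) = 1" by (simp add: numeral_fps_const)
  then show ?thesis by (simp add: e0_def flip: mult.assoc)
qed

lemma Z_powers: "Z ^ n * z ^ n = 1"
  using Zz by (simp flip: power_mult_distrib)

lemma Z_nonzero: "Z \<noteq> 0"
  using Zz by auto

lemma rel1_tau: "A0 * (A0 + 4 * e0) ^ 3 = 256 * fps_X"
proof -
  have "Z ^ 12 * (A0 * (A0 + 4 * e0) ^ 3) = (Z ^ 3 * z ^ 3) ^ 4 * ((Z\<^sup>2 - 1) * ((Z\<^sup>2 + 3) * Z\<^sup>2) ^ 3)"
    unfolding e0 A0_def by algebra
  also have "\<dots> = Z ^ 6 * (256 * fps_X * Z ^ 6)" unfolding Z_powers power_one Z_eq by algebra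
  also have "\<dots> = Z ^ 12 * (256 * fps_X)" by algebra
  finally show ?thesis using Z_nonzero by (simp only: mult_cancel_left) simp
qed

lemma rel2_tau: "2 * e0\<^sup>2 + 10 * A0 * e0 - A0\<^sup>2 = 2 + 32 * fps_X"
proof -
  have "8 * Z ^ 6 * (2 * e0\<^sup>2 + 10 * A0 * e0 - A0\<^sup>2) =
      Z ^ 6 * ((4 * e0)\<^sup>2 + 20 * A0 * (4 * e0) - 8 * A0\<^sup>2)" by algebra
  also have "\<dots> = (Z ^ 3 * z ^ 3)\<^sup>2 * ((Z\<^sup>2 + 1) ^ 4 + 20 * (Z\<^sup>2 - 1) * (Z\<^sup>2 + 1)\<^sup>2 - 8 * (Z\<^sup>2 - 1)\<^sup>2)"
    unfolding e0 A0_def by algebra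
  also have "\<dots> = 16 * Z ^ 6 + (Z\<^sup>2 - 1) * (Z\<^sup>2 + 3) ^ 3" unfolding Z_powers power_one by algebra
  also have "\<dots> = 8 * Z ^ 6 * (2 + 32 * fps_X)" unfolding Z_eq[symmetric] by algebra
  finally show ?thesis using Z_nonzero by (simp only: mult_cancel_left) simp
qed

lemma rhs_tau: "8 * (A0 * e0 * (2 * e0 + A0)) = (Z\<^sup>2 - 1) * (Z\<^sup>2 + 1)\<^sup>2 * (Z ^ 4 + 4 * Z\<^sup>2 - 1) * z ^ 9"
proof -
  have "2 * (8 * (A0 * e0 * (2 * e0 + A0))) = 2 * (A0 * (4 * e0) * (4 * e0 + 2 * A0))" by algebra
  also have "\<dots> = 2 * ((Z\<^sup>2 - 1) * (Z\<^sup>2 + 1)\<^sup>2 * (Z ^ 4 + 4 * Z\<^sup>2 - 1) * z ^ 9)"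
    unfolding e0 A0_def by algebra
  finally show ?thesis by (simp only: mult_cancel_left) simp
qed

lemma A0_factor: "A0 = fps_X * (256 * Z ^ 6 * inverse ((Z\<^sup>2 + 3) ^ 3) * z ^ 3)"
proof -
  have "(Z\<^sup>2 + 3) ^ 3 * inverse ((Z\<^sup>2 + 3) ^ 3) = 1"
    by (rule inverse_mult_eq_1') (simp add: fps_power_zeroth Z0 fps_numeral_nth)
  moreover have "fps_X * (256 * Z ^ 6 * inverse ((Z\<^sup>2 + 3) ^ 3) * z ^ 3) =
      256 * fps_X * Z ^ 6 * (inverse ((Z\<^sup>2 + 3) ^ 3) * z ^ 3)" by algebra
  ultimately show ?thesis unfolding Z_eq A0_def by algebra
qed

lemma e0_zero: "fps_nth e0 0 = 1"
proof -
  have "fps_nth z 0 = 1" by (simp add: z_def Z0)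
  then show ?thesis by (simp add: e0_def fps_power_zeroth Z0)
qed

end

lemma compose_X2_nth: "fps_nth (F oo fps_X\<^sup>2) (2 * n) = fps_nth F n" for F :: "real fps"
proof -
  have "fps_nth (F oo fps_X\<^sup>2) (2 * n) = (\<Sum>i=0..2*n. fps_nth F i * (if i = n then 1 else 0))"
    unfolding fps_compose_nth
    by (intro sum.cong refl) (auto simp: fps_X_power_nth simp flip: power_mult)
  also have "\<dots> = (\<Sum>i\<in>{n}. fps_nth F i)"
    by (intro sum.mono_neutral_cong_right) auto
  finally show ?thesis by simp
qed

definition algebraic_part :: "nat \<Rightarrow> real" where
  "algebraic_part n = 4 * 16 ^ n / 243 *
      (4 * (24 * real n ^ 2 + 60 * real n + 29) *
         (pochhammer (1/2) n * pochhammer (7/6) n / (pochhammer 2 (n + 1) * pochhammer (4/3) (n + 1)))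
       - 2 * (12 * real n ^ 2 + 30 * real n + 5) *
         (pochhammer (1/2) n * pochhammer (5/6) n / (pochhammer 2 (n + 1) * pochhammer (5/3) (n + 1))))"

lemma wedge_num_origin: "wedge_num (2 * n) (0, 0) = algebraic_part n"
proof -
  obtain Z where "Z_series Z" using Z_exists by blast
  then interpret Z_series Z .
  define \<alpha> where "\<alpha> = 256 * Z ^ 6 * inverse ((Z\<^sup>2 + 3) ^ 3) * z ^ 3"
  define s where "s f = f oo fps_X\<^sup>2" for f :: "real fps"
  have X0: "fps_nth (fps_X\<^sup>2 :: real fps) 0 = 0" by simp
  have s_mult: "s (f * g) = s f * s g" for f g unfolding s_def by (rule fps_compose_mult_distrib[OF X0])
  have s_power: "s (f ^ n) = s f ^ n" for f n unfolding s_def by (rule fps_compose_power[OF X0, symmetric])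
  have s_add: "s (f + g) = s f + s g" for f g by (simp add: s_def fps_compose_add_distrib)
  have s_diff: "s (f - g) = s f - s g" for f g by (simp add: s_def fps_compose_sub_distrib)
  have s_num: "s (numeral m) = numeral m" for m by (simp add: s_def numeral_fps_const)
  have s_X: "s fps_X = fps_X\<^sup>2" unfolding s_def by (rule fps_X_fps_compose_startby0[OF X0])
  note s = s_mult s_power s_add s_diff s_num s_X
  define \<epsilon> where "\<epsilon> = fps_shift 1 (s e0)"
  have se0: "fps_nth (s e0) 0 = 1" using compose_X2_nth[of e0 0] e0_zero by (simp add: s_def)
  interpret curve_parameters "s A0" "s e0" "s \<alpha>" \<epsilon>
  proof
    show "s A0 = fps_X\<^sup>2 * s \<alpha>"
      using arg_cong[OF A0_factor, of s] by (simp only: \<alpha>_def[symmetric] s)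
    show "s e0 = 1 + fps_X * \<epsilon>"
      by (rule fps_ext) (auto simp: \<epsilon>_def se0)
    show "256 * fps_X\<^sup>2 = s A0 * (s A0 + 4 * s e0) ^ 3"
      using arg_cong[OF rel1_tau, of s] by (simp only: s)
    show "2 * (s e0)\<^sup>2 + 10 * s A0 * s e0 - (s A0)\<^sup>2 = 2 + 32 * fps_X\<^sup>2"
      using arg_cong[OF rel2_tau, of s] by (simp only: s)
  qed
  have "8 * (s A0 * s e0 * (2 * s e0 + s A0)) = s (8 * (A0 * e0 * (2 * e0 + A0)))" by (simp only: s)
  also have "\<dots> = s (64 * fps_X + 96 * fps_X\<^sup>2 * Abs_fps algebraic_part)"
    unfolding rhs_tau algebraic_series algebraic_part_def ..
  also have "\<dots> = 64 * fps_X\<^sup>2 + 96 * fps_X ^ 4 * s (Abs_fps algebraic_part)"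
    by (simp only: s flip: power_mult) simp
  finally have "8 * (12 * fps_X ^ 4 * Abs_fps (\<lambda>n. wedge_num n (0, 0)) + 8 * fps_X\<^sup>2) =
      64 * fps_X\<^sup>2 + 96 * fps_X ^ 4 * s (Abs_fps algebraic_part)"
    unfolding diagonal_series .
  moreover have "8 * (12 * a * f + 8 * b) = 64 * b + 96 * a * g \<Longrightarrow> 96 * a * f = 96 * a * g" for a b f g :: "real fps"
    by (simp add: algebra_simps)
  ultimately have "96 * fps_X ^ 4 * Abs_fps (\<lambda>n. wedge_num n (0, 0)) = 96 * fps_X ^ 4 * s (Abs_fps algebraic_part)"
    by blast
  then have "Abs_fps (\<lambda>n. wedge_num n (0, 0)) = s (Abs_fps algebraic_part)" by (simp only: mult_cancel_left) simp
  from arg_cong[OF this, of "\<lambda>f. fps_nth f (2 * n)"] show ?thesis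
    by (simp add: s_def compose_X2_nth)
qed

lemma central_binomial_neighbours:
  "real (2 * n choose (n + 1)) = real (2 * n choose n) * n / (n + 1)"
  "real (2 * n choose (n + 2)) = real (2 * n choose (n + 1)) * (real n - 1) / (n + 2)"
proof -
  have step: "d * f = r * g \<Longrightarrow> d \<noteq> 0 \<Longrightarrow> f = g * r / d" for d f r g :: real
    by (simp add: field_simps)
  show "real (2 * n choose (n + 1)) = real (2 * n choose n) * n / (n + 1)"
  proof (cases n)
    case (Suc m)
    then have m: "Suc (n + m) = 2 * n" "Suc m = n" by simp_all
    have "(n + 1) * (2 * n choose (n + 1)) = n * (2 * n choose n)"
      using Suc_times_binomial_add[of n m] unfolding m by (simp only: Suc_eq_plus1)
    then have "real (n + 1) * real (2 * n choose (n + 1)) = real n * real (2 * n choose n)"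
      by (simp only: flip: of_nat_mult)
    then show ?thesis by (rule step) (simp only: of_nat_eq_0_iff add_eq_0_iff_both_eq_0 zero_neq_one one_neq_zero simp_thms)
  qed simp
  show "real (2 * n choose (n + 2)) = real (2 * n choose (n + 1)) * (real n - 1) / (n + 2)"
  proof (cases "n < 2")
    case True
    then have "n = 0 \<or> n = 1" by auto
    then show ?thesis by auto
  next
    case False
    then obtain m where n: "n = m + 2" by (metis add.commute le_Suc_ex not_less)
    then have m: "Suc (n + 1 + m) = 2 * n" "Suc (n + 1) = n + 2" "Suc m = n - 1" by simp_all
    have "(n + 2) * (2 * n choose (n + 2)) = (n - 1) * (2 * n choose (n + 1))"
      using Suc_times_binomial_add[of "n + 1" m] unfolding m .
    then have "real (n + 2) * real (2 * n choose (n + 2)) = real (n - 1) * real (2 * n choose (n + 1))"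
      by (simp only: flip: of_nat_mult)
    moreover have pred: "real (n - 1) = real n - 1" using n by simp
    ultimately have "real (n + 2) * real (2 * n choose (n + 2)) = (real n - 1) * real (2 * n choose (n + 1))"
      by (simp only: pred)
    then show ?thesis by (rule step) (simp only: of_nat_eq_0_iff add_eq_0_iff_both_eq_0 zero_neq_numeral simp_thms
      numeral_neq_zero)
  qed
qed

text \<open>The reflection principle gives a product of two consecutive Catalan numbers.\<close>

lemma quad_num_pochhammer:
  "quad_num 0 0 (2 * n) = 4 * 16 ^ n * (pochhammer (1/2) n * pochhammer (1/2) (n + 1)
                    / (pochhammer 2 n * pochhammer 2 (n + 1)))"
proof -
  define c x u v where "c = real (2 * n choose n)" and "x = real n" and "u = x + 1" and "v = x + 2"
  have nz: "u \<noteq> 0" "v \<noteq> 0" by (auto simp: u_def v_def x_def)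
  have "fact n * fact n * (2 * n choose n) = (fact (2 * n) :: nat)"
    using binomial_fact_lemma[of n "2 * n"] by (simp add: mult_2)
  then have "fact n * fact n * c = (fact (2 * n) :: real)"
    unfolding c_def by (metis of_nat_mult of_nat_fact)
  also have "\<dots> = 4 ^ n * pochhammer (1/2) n * fact n"
    by (simp only: fact_double power_mult) simp
  finally have "fact n * (4 ^ n * pochhammer (1/2) n) = fact n * (c * fact n)"
    by (simp only: mult_ac)
  then have p: "4 ^ n * pochhammer (1/2) n = c * fact n"
    by (simp only: mult_cancel_left fact_nonzero simp_thms)
  have f: "pochhammer 2 m = (fact (m + 1) :: real)" for m
    using pochhammer_rec[of "1 :: real" m] by (simp add: pochhammer_fact)
  have "4 * 16 ^ n * (pochhammer (1/2) n * pochhammer (1/2) (n + 1) / (pochhammer 2 n * pochhammer 2 (n + 1)))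
    = 4 * ((4 ^ n * pochhammer (1/2) n) * (4 ^ n * pochhammer (1/2) n) * (1/2 + x)) / (fact (n + 1) * fact (n + 1 + 1))"
  proof -
    have "(16 :: real) ^ n = 4 ^ n * 4 ^ n" by (simp flip: power_mult_distrib)
    moreover have "pochhammer (1/2) (n + 1) = (1/2 + x) * pochhammer (1/2) n"
      by (simp add: pochhammer_rec' x_def)
    ultimately show ?thesis unfolding f by (simp only: times_divide_eq_right mult_ac)
  qed
  also have "fact (n + 1) * fact (n + 1 + 1) = (u * fact n) * (v * (u * (fact n :: real)))"
    by (simp add: u_def v_def x_def algebra_simps)
  also have "4 * ((4 ^ n * pochhammer (1/2) n) * (4 ^ n * pochhammer (1/2) n) * (1/2 + x)) /
      ((u * fact n) * (v * (u * fact n))) = c\<^sup>2 * (4 * x + 2) / (u\<^sup>2 * v)"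
    unfolding p using nz by (simp add: field_simps power2_eq_square)
  also have "4 * x + 2 = u\<^sup>2 * v - 2 * x\<^sup>2 * v + x * (x - 1) * u"
    unfolding u_def v_def by algebra
  also have "c\<^sup>2 * (u\<^sup>2 * v - 2 * x\<^sup>2 * v + x * (x - 1) * u) / (u\<^sup>2 * v)
      = c\<^sup>2 - 2 * (c * x / u)\<^sup>2 + c * ((c * x / u) * (x - 1) / v)"
    using nz by (simp add: field_simps power2_eq_square)
  also have "\<dots> = quad_num 0 0 (2 * n)"
    unfolding quad_num_origin central_binomial_neighbours c_def u_def v_def x_def by (simp add: add.commute)
  finally show ?thesis by simp
qed

lemma cone_walk_count_formula:
  "real (cone_walk_count 0 0 (2 * n)) = 4 * 16 ^ n / 3 ^ 5 *
        (3 ^ 4 * (pochhammer (1/2) n * pochhammer (1/2) (n + 1)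
                    / (pochhammer 2 n * pochhammer 2 (n + 1)))
         + 4 * (24 * real n ^ 2 + 60 * real n + 29)
             * (pochhammer (1/2) n * pochhammer (7/6) n
                    / (pochhammer 2 (n + 1) * pochhammer (4/3) (n + 1)))
         - 2 * (12 * real n ^ 2 + 30 * real n + 5)
             * (pochhammer (1/2) n * pochhammer (5/6) n
                    / (pochhammer 2 (n + 1) * pochhammer (5/3) (n + 1))))"
proof -
  have split: "real (cone_walk_count 0 0 (2 * n)) = quad_num 0 0 (2 * n) / 3 + wedge_num (2 * n) (0, 0)"
    by (simp add: wedge_num_def reduced_num_def cone_num_def)
  have collect: "4 * c * p / 3 + 4 * c / 243 * (a - b) = 4 * c / 3 ^ 5 * (3 ^ 4 * p + a - b)" for a b c p :: real
    by (simp add: field_simps)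
  show ?thesis
    unfolding split quad_num_pochhammer wedge_num_origin algebraic_part_def by (rule collect)
qed

section \<open>The asymptotics\<close>

text \<open>The reciprocal of Euler's sequence for the Gamma function.\<close>

definition poch_ratio :: "real \<Rightarrow> nat \<Rightarrow> real" where
  "poch_ratio a n = pochhammer a (n + 1) / (fact n * real n powr a)"

lemma poch_ratio_tendsto: "a > 0 \<Longrightarrow> poch_ratio a \<longlonglongrightarrow> inverse (Gamma a)"
proof -
  assume a: "a > 0"
  have "Gamma a \<noteq> 0" using Gamma_real_pos[OF a] by linarith
  then have "(\<lambda>n. inverse (Gamma_series a n)) \<longlonglongrightarrow> inverse (Gamma a)"
    by (intro tendsto_inverse Gamma_series_LIMSEQ)
  moreover have "eventually (\<lambda>n. inverse (Gamma_series a n) = poch_ratio a n) sequentially"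
    using eventually_gt_at_top[of 0]
    by eventually_elim (simp add: Gamma_series_def poch_ratio_def powr_def field_simps)
  ultimately show ?thesis by (rule Lim_transform_eventually)
qed

lemma pochhammer_Suc_ratio: "n > 0 \<Longrightarrow> pochhammer a (n + 1) = poch_ratio a n * (fact n * real n powr a)"
  by (simp add: poch_ratio_def)

lemma pochhammer_ratio: "n > 0 \<Longrightarrow> a > 0 \<Longrightarrow> pochhammer a n = poch_ratio a n * (fact n * real n powr a) / (a + n)"
  by (simp add: poch_ratio_def pochhammer_rec')

lemma hyp_limit:
  assumes a: "a > 0" "b > 0" "c > 0" "d > 0"
    and e: "e = c + d - a - b" and q: "(\<lambda>n. q n / ((a + real n) * (b + real n))) \<longlonglongrightarrow> l"
  shows "(\<lambda>n. q n * (pochhammer a n * pochhammer b n / (pochhammer c (n + 1) * pochhammer d (n + 1))) * real n powr e)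
    \<longlonglongrightarrow> l * (Gamma c * Gamma d / (Gamma a * Gamma b))"
proof -
  have pos: "Gamma a \<noteq> 0" "Gamma b \<noteq> 0" "Gamma c \<noteq> 0" "Gamma d \<noteq> 0"
    using a Gamma_real_pos less_irrefl by metis+
  have "(\<lambda>n. q n / ((a + real n) * (b + real n)) *
      (poch_ratio a n * poch_ratio b n / (poch_ratio c n * poch_ratio d n)))
    \<longlonglongrightarrow> l * (inverse (Gamma a) * inverse (Gamma b) / (inverse (Gamma c) * inverse (Gamma d)))"
    using a pos by (intro tendsto_intros q poch_ratio_tendsto) auto
  also have "l * (inverse (Gamma a) * inverse (Gamma b) / (inverse (Gamma c) * inverse (Gamma d))) =
      l * (Gamma c * Gamma d / (Gamma a * Gamma b))"
    using pos by (simp add: field_simps)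
  finally have "(\<lambda>n. q n / ((a + real n) * (b + real n)) *
      (poch_ratio a n * poch_ratio b n / (poch_ratio c n * poch_ratio d n)))
    \<longlonglongrightarrow> l * (Gamma c * Gamma d / (Gamma a * Gamma b))" .
  moreover have "eventually (\<lambda>n. q n / ((a + real n) * (b + real n)) *
      (poch_ratio a n * poch_ratio b n / (poch_ratio c n * poch_ratio d n)) =
     q n * (pochhammer a n * pochhammer b n / (pochhammer c (n + 1) * pochhammer d (n + 1))) * real n powr e) sequentially"
    using eventually_gt_at_top[of 0]
  proof eventually_elim
    case (elim n)
    define x where "x = real n"
    have x: "x > 0" using elim by (simp add: x_def)
    have pw: "x powr a * x powr b / (x powr c * x powr d) * x powr e = 1"
      using x by (simp add: e powr_diff powr_add field_simps)
    have "q n * (pochhammer a n * pochhammer b n / (pochhammer c (n + 1) * pochhammer d (n + 1))) * x powr e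
      = q n / ((a + x) * (b + x)) * (poch_ratio a n * poch_ratio b n / (poch_ratio c n * poch_ratio d n))
        * (x powr a * x powr b / (x powr c * x powr d) * x powr e)"
      using elim a unfolding pochhammer_Suc_ratio[OF elim] pochhammer_ratio[OF elim a(1)] pochhammer_ratio[OF elim a(2)]
      by (simp add: x_def mult_ac)
    then show ?case unfolding pw by (simp add: x_def)
  qed
  ultimately show ?thesis by (rule Lim_transform_eventually)
qed

text \<open>The duplication formula at \<open>2/3\<close>.\<close>

lemma Gamma_quotient: "Gamma (4/3 :: real) / Gamma (7/6) = Gamma (2/3) * 2 powr (1/3) / sqrt pi"
proof -
  have nz: "complex_of_real (2/3) \<notin> \<int>\<^sub>\<le>\<^sub>0" "complex_of_real (2/3) + 1/2 \<notin> \<int>\<^sub>\<le>\<^sub>0"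
    by (auto elim!: nonpos_Ints_cases simp: complex_eq_iff)
  have "complex_of_real (Gamma (2/3) * Gamma (7/6)) =
     Gamma (complex_of_real (2/3)) * Gamma (complex_of_real (2/3) + 1/2)"
    by (simp flip: Gamma_complex_of_real)
  also have "\<dots> = exp ((1 - 2 * complex_of_real (2/3)) * of_real (ln 2)) * of_real (sqrt pi) * Gamma (2 * complex_of_real (2/3))"
    by (rule Gamma_legendre_duplication[OF nz])
  also have "(1 - 2 * complex_of_real (2/3)) * of_real (ln 2) = of_real ((1 - 2 * (2/3)) * ln 2)"
    by simp
  also have "2 * complex_of_real (2/3) = of_real (2 * (2/3))" by simp
  also have "exp (of_real ((1 - 2 * (2/3)) * ln 2)) * of_real (sqrt pi) * Gamma (of_real (2 * (2/3)))
      = complex_of_real (exp ((1 - 2 * (2/3)) * ln 2) * sqrt pi * Gamma (2 * (2/3)))"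
  proof -
    have "exp (of_real r) * of_real p * Gamma (of_real t) = complex_of_real (exp r * p * Gamma t)" for r p t :: real
      by (simp add: exp_of_real Gamma_complex_of_real)
    then show ?thesis by blast
  qed
  finally have "Gamma (2/3) * Gamma (7/6 :: real) = exp ((1 - 2 * (2/3)) * ln 2) * sqrt pi * Gamma (2 * (2/3))"
    by (simp only: of_real_eq_iff)
  also have "exp ((1 - 2 * (2/3)) * ln 2) = inverse (2 powr (1/3 :: real))"
    by (simp add: powr_def flip: exp_minus)
  finally have "Gamma (2/3) * Gamma (7/6 :: real) * 2 powr (1/3) = sqrt pi * Gamma (4/3)"
    by (simp add: field_simps)
  moreover have "Gamma (7/6 :: real) > 0" by (rule Gamma_real_pos) simp
  then have "Gamma (7/6 :: real) \<noteq> 0" by linarith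
  ultimately show ?thesis by (simp add: field_simps)
qed

lemma cone_walk_count_limit:
  "(\<lambda>n. real (cone_walk_count 0 0 (2 * n)) / 16 ^ n * real n powr (5/3))
     \<longlonglongrightarrow> 128/81 * (2 powr (1/3) * Gamma (2/3) / pi)"
proof -
  define h1 where "h1 n = (pochhammer (1/2) n * pochhammer (1/2) (n + 1) / (pochhammer 2 n * pochhammer 2 (n + 1)) :: real)" for n
  define h2 where "h2 n = (24 * real n ^ 2 + 60 * real n + 29) * (pochhammer (1/2) n * pochhammer (7/6) n
                    / (pochhammer 2 (n + 1) * pochhammer (4/3) (n + 1)))" for n
  define h3 where "h3 n = (12 * real n ^ 2 + 30 * real n + 5) * (pochhammer (1/2) n * pochhammer (5/6) n
                    / (pochhammer 2 (n + 1) * pochhammer (5/3) (n + 1)))" for n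
  have l2: "(\<lambda>n. h2 n * real n powr (5/3)) \<longlonglongrightarrow> 24 * (Gamma 2 * Gamma (4/3) / (Gamma (1/2) * Gamma (7/6)))"
    unfolding h2_def by (rule hyp_limit) (simp_all, real_asymp)
  have "(\<lambda>n. h3 n * real n powr (7/3)) \<longlonglongrightarrow> 12 * (Gamma 2 * Gamma (5/3) / (Gamma (1/2) * Gamma (5/6)))"
    unfolding h3_def by (rule hyp_limit) (simp_all, real_asymp)
  moreover have "(\<lambda>n. real n powr (-2/3)) \<longlonglongrightarrow> 0" by real_asymp
  ultimately have "(\<lambda>n. h3 n * real n powr (7/3) * real n powr (-2/3)) \<longlonglongrightarrow>
      12 * (Gamma 2 * Gamma (5/3) / (Gamma (1/2) * Gamma (5/6))) * 0"
    by (rule tendsto_mult)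
  moreover have "h3 n * real n powr (7/3) * real n powr (-2/3) = h3 n * real n powr (5/3)" for n
    by (simp add: mult.assoc flip: powr_add)
  ultimately have l3: "(\<lambda>n. h3 n * real n powr (5/3)) \<longlonglongrightarrow> 0" by (simp only: mult_zero_right)
  have h1: "h1 n = ((real n + 1/2) * (real n + 2)) *
      (pochhammer (1/2) n * pochhammer (1/2) n / (pochhammer 2 (n + 1) * pochhammer 2 (n + 1)))" for n
  proof -
    have "pochhammer (2 :: real) (n + 1) = (2 + real n) * pochhammer 2 n"
      "pochhammer (1/2) (n + 1) = (1/2 + real n) * pochhammer (1/2) n"
      by (simp_all add: pochhammer_rec')
    moreover have "d * (u * d) / (b * (v * b)) = (u * v) * (d * d / (v * b * (v * b)))"
      if "v \<noteq> 0" "b \<noteq> 0" for b d u v :: real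
      using that by (simp add: field_simps)
    moreover have "2 + real n \<noteq> 0" "pochhammer (2 :: real) n \<noteq> 0"
      using pochhammer_pos[of "2 :: real" n] by simp_all
    ultimately show ?thesis by (simp only: h1_def add.commute[of _ "1/2"] add.commute[of _ 2])
  qed
  have "(\<lambda>n. h1 n * real n powr 3) \<longlonglongrightarrow> 1 * (Gamma 2 * Gamma 2 / (Gamma (1/2) * Gamma (1/2)))"
    unfolding h1 by (rule hyp_limit) (simp_all, real_asymp)
  moreover have "(\<lambda>n. real n powr (-4/3)) \<longlonglongrightarrow> 0" by real_asymp
  ultimately have "(\<lambda>n. h1 n * real n powr 3 * real n powr (-4/3)) \<longlonglongrightarrow>
      1 * (Gamma 2 * Gamma 2 / (Gamma (1/2) * Gamma (1/2))) * 0"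
    by (rule tendsto_mult)
  moreover have "h1 n * real n powr 3 * real n powr (-4/3) = h1 n * real n powr (5/3)" for n
  proof -
    have "real n powr 3 * real n powr (-4/3) = real n powr (3 + -4/3)" by (rule powr_add[symmetric])
    then show ?thesis by (simp only: mult.assoc) simp
  qed
  ultimately have l1: "(\<lambda>n. h1 n * real n powr (5/3)) \<longlonglongrightarrow> 0" by (simp only: mult_zero_right)
  have "(\<lambda>n. 4 / 243 * (81 * (h1 n * real n powr (5/3)) + 4 * (h2 n * real n powr (5/3)) - 2 * (h3 n * real n powr (5/3))))
     \<longlonglongrightarrow> 4 / 243 * (81 * 0 + 4 * (24 * (Gamma 2 * Gamma (4/3) / (Gamma (1/2) * Gamma (7/6)))) - 2 * 0)"
    by (intro tendsto_intros l1 l2 l3)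
  moreover have "4 / 243 * (81 * (h1 n * real n powr (5/3)) + 4 * (h2 n * real n powr (5/3)) - 2 * (h3 n * real n powr (5/3)))
     = real (cone_walk_count 0 0 (2 * n)) / 16 ^ n * real n powr (5/3)" for n
  proof -
    have "real (cone_walk_count 0 0 (2 * n)) = 16 ^ n * (4 / 243 * (81 * h1 n + 4 * h2 n - 2 * h3 n))"
    proof -
      have "4 * c / 3 ^ 5 * (3 ^ 4 * f + 4 * p * g - 2 * q * h) = c * (4 / 243 * (81 * f + 4 * (p * g) - 2 * (q * h)))"
        for c f g h p q :: real
        by (simp add: field_simps)
      then show ?thesis unfolding cone_walk_count_formula h1_def h2_def h3_def by blast
    qed
    then have quotient: "real (cone_walk_count 0 0 (2 * n)) / 16 ^ n = 4 / 243 * (81 * h1 n + 4 * h2 n - 2 * h3 n)"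
      by simp
    show ?thesis unfolding quotient by (simp add: algebra_simps)
  qed
  moreover have "4 / 243 * (81 * 0 + 4 * (24 * (Gamma 2 * Gamma (4/3) / (Gamma (1/2) * Gamma (7/6)))) - 2 * 0)
     = 128/81 * (2 powr (1/3) * Gamma (2/3) / pi)"
  proof -
    have two: "Gamma (2 :: real) = 1" using Gamma_fact[of 1, where 'a = real] by simp
    have "Gamma (4/3) / (Gamma (1/2) * Gamma (7/6)) = (Gamma (4/3) / Gamma (7/6)) / (sqrt pi :: real)"
      by (simp add: Gamma_one_half_real)
    also have "\<dots> = Gamma (2/3) * 2 powr (1/3) / (sqrt pi * sqrt pi)"
      unfolding Gamma_quotient by simp
    finally have "Gamma (4/3) / (Gamma (1/2) * Gamma (7/6)) = Gamma (2/3) * 2 powr (1/3) / (pi :: real)" by simp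
    then show ?thesis by (simp only: two mult_1_left) simp
  qed
  ultimately show ?thesis by simp
qed

theorem mainTheorem10:
  shows "(\<forall>n::nat. real (cone_walk_count 0 0 (2 * n)) =
      4 * 16 ^ n / 3 ^ 5 *
        (3 ^ 4 * (pochhammer (1/2) n * pochhammer (1/2) (n + 1)
                    / (pochhammer 2 n * pochhammer 2 (n + 1)))
         + 4 * (24 * real n ^ 2 + 60 * real n + 29)
             * (pochhammer (1/2) n * pochhammer (7/6) n
                    / (pochhammer 2 (n + 1) * pochhammer (4/3) (n + 1)))
         - 2 * (12 * real n ^ 2 + 30 * real n + 5)
             * (pochhammer (1/2) n * pochhammer (5/6) n
                    / (pochhammer 2 (n + 1) * pochhammer (5/3) (n + 1)))))
    \<and> (\<lambda>n::nat. real (cone_walk_count 0 0 (2 * n)))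
        \<sim>[at_top]
      (\<lambda>n. 2 ^ 9 / 3 ^ 4 * (Gamma (2/3) / pi) * (4 ^ (2 * n) / real (2 * n) powr (5/3)))"
proof (intro conjI allI)
  define C where "C = 128/81 * (2 powr (1/3) * Gamma (2/3) / pi)"
  have "Gamma (2/3 :: real) > 0" by (rule Gamma_real_pos) simp
  then have "Gamma (2/3 :: real) \<noteq> 0" by linarith
  then have C: "C \<noteq> 0" by (simp add: C_def)
  have "(\<lambda>n. real (cone_walk_count 0 0 (2 * n)) / 16 ^ n * real n powr (5/3) / C) \<longlonglongrightarrow> C / C"
    using cone_walk_count_limit C unfolding C_def by (intro tendsto_divide tendsto_const) auto
  moreover have "real (cone_walk_count 0 0 (2 * n)) / 16 ^ n * real n powr (5/3) / C =
    real (cone_walk_count 0 0 (2 * n)) / (2 ^ 9 / 3 ^ 4 * (Gamma (2/3) / pi) * (4 ^ (2 * n) / real (2 * n) powr (5/3)))" for n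
  proof -
    have "(2 :: real) powr (5/3) * 2 powr (1/3) = 2 powr 2" by (simp flip: powr_add)
    then have p: "(2 :: real) powr (5/3) * 2 powr (1/3) = 4" by simp
    have "2 ^ 9 / 3 ^ 4 * (Gamma (2/3) / pi) * (4 ^ (2 * n) / real (2 * n) powr (5/3)) =
       128/81 * (Gamma (2/3) / pi) * 16 ^ n * (4 / 2 powr (5/3)) / real n powr (5/3)"
      by (simp add: power_mult powr_mult)
    also have "4 / 2 powr (5/3) = (2 :: real) powr (1/3)"
      using p by (simp add: field_simps)
    finally show ?thesis by (simp add: C_def mult_ac)
  qed
  ultimately show "(\<lambda>n. real (cone_walk_count 0 0 (2 * n))) \<sim>[at_top]
      (\<lambda>n. 2 ^ 9 / 3 ^ 4 * (Gamma (2/3) / pi) * (4 ^ (2 * n) / real (2 * n) powr (5/3)))"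
    using C by (intro asymp_equivI') simp
qed (rule cone_walk_count_formula)

end
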